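(* For all unitary modified types $\boldsymbol\mu,\boldsymbol\nu,\boldsymbol\lambda$ there exist polynomials $r_{\boldsymbol\mu,\boldsymbol\nu}^{\boldsymbol\lambda}\in\mathcal{R}_{-q}$, only finitely many nonzero for fixed $\boldsymbol\mu,\boldsymbol\nu$, such that for every integer $n\ge0$, in $Z(\mathbb{Z}U_n(\mathbb{F}_q))$, \[ X_{\boldsymbol\mu,n}X_{\boldsymbol\nu,n}=\sum_{\boldsymbol\lambda}r_{\boldsymbol\mu,\boldsymbol\nu}^{\boldsymbol\lambda}([n]_{-q})\,X_{\boldsymbol\lambda,n}, \] the sum ranging over all unitary modified types.
   Context: $q$ is a fixed prime power and $\sigma(z)=z^q$ on $\mathbb{F}_{q^2}$. $U_n(\mathbb{F}_q)=\{g\in GL_n(\mathbb{F}_{q^2}): g^T\sigma(g)=\mathrm{Id}\}$ is the symmetry group of the Hermitian form $B_n(x,y)=\sum_{i=1}^n x_i\sigma(y_i)$ (here $\sigma(g)$ applies $\sigma$ entrywise). We embed $U_n(\mathbb{F}_q)\subset U_{n+1}(\mathbb{F}_q)$ by $g\mapsto\operatorname{diag}(g,1)$. Elements $g\in U_n(\mathbb{F}_q)$, $g'\in U_{n'}(\mathbb{F}_q)$ are said to have the same (unitary) modified type if for some $N\ge n,n'$ their images in $U_N(\mathbb{F}_q)$ are conjugate in $U_N(\mathbb{F}_q)$; a unitary modified type is an equivalence class under this relation. Its size $|\boldsymbol\mu|$ is $\operatorname{rank}(g-\mathrm{Id})$ for any $g$ in the class. $X_{\boldsymbol\mu,n}$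 is the sum of all elements of $U_n(\mathbb{F}_q)$ of modified type $\boldsymbol\mu$ (zero if none). For $n\in\mathbb{Z}$, $[n]_{-q}=((-q)^n-1)/((-q)-1)$, $[k]_{-q}!=[k]_{-q}\cdots[1]_{-q}$, and $\binom{x}{k}_{-q}=\frac{x(x-[1]_{-q})\cdots(x-[k-1]_{-q})}{(-q)^{k(k-1)/2}[k]_{-q}!}$. $\mathcal{R}_{-q}$ is the set of $\mathbb{Z}[q,q^{-1}]$-linear combinations (in $\mathbb{Q}[x]$) of the $\binom{x}{k}_{-q}$, $k\ge0$. *)

theory Defs
  imports "Jordan_Normal_Form.Matrix" "HOL-Computational_Algebra.Polynomial"
          "HOL-Computational_Algebra.Primes"
begin

(* Frobenius sigma(z) = z^q on the field F_{q^2} (modelled by a finite field type 'k with CARD('k) = q^2) *)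
definition frob :: "nat \<Rightarrow> 'k::field \<Rightarrow> 'k" where
  "frob q z = z ^ q"

definition unitary_group :: "nat \<Rightarrow> nat \<Rightarrow> 'k::field mat set" where
  "unitary_group q n = {g \<in> carrier_mat n n.
      (\<exists>g'. g * g' = 1\<^sub>m n \<and> g' * g = 1\<^sub>m n) \<and>
      transpose_mat g * map_mat (frob q) g = 1\<^sub>m n}"

definition embed_mat :: "nat \<Rightarrow> 'k::field mat \<Rightarrow> 'k mat" where
  "embed_mat N g = mat N N (\<lambda>(i,j).
      if i < dim_row g \<and> j < dim_row g then g $$ (i,j)
      else if i = j then 1 else 0)"

definition same_modtype :: "nat \<Rightarrow> 'k::field mat \<Rightarrow> 'k mat \<Rightarrow> bool" where
  "same_modtype q g g' \<longleftrightarrow>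
     (\<exists>n n'. g \<in> unitary_group q n \<and> g' \<in> unitary_group q n') \<and>
     (\<exists>N. N \<ge> dim_row g \<and> N \<ge> dim_row g' \<and>
        (\<exists>h h'. h \<in> unitary_group q N \<and> h * h' = 1\<^sub>m N \<and> h' * h = 1\<^sub>m N \<and>
               embed_mat N g' = h * embed_mat N g * h'))"

definition modtypes :: "nat \<Rightarrow> 'k::field mat set set" where
  "modtypes q = {C. \<exists>n g. g \<in> unitary_group q n \<and> C = {g'. same_modtype q g g'}}"

(* X_{mu,n}: sum of elements of U_n of type mu, as an element of the group algebra
   Q U_n (containing Z U_n), represented as a coefficient function on matrices *)
definition class_sum :: "nat \<Rightarrow> 'k::field mat set \<Rightarrow> nat \<Rightarrow> 'k mat \<Rightarrow> rat" where
  "class_sum q mu n = (\<lambda>g. if g \<in> mu \<and> g \<in> unitary_group q n then 1 else 0)"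

definition galg_mult :: "nat \<Rightarrow> nat \<Rightarrow> ('k::field mat \<Rightarrow> rat) \<Rightarrow> ('k mat \<Rightarrow> rat) \<Rightarrow> ('k mat \<Rightarrow> rat)" where
  "galg_mult q n a b = (\<lambda>g. \<Sum>(x,y)\<in>{(x,y). x \<in> unitary_group q n \<and> y \<in> unitary_group q n \<and> x * y = g}.
                                a x * b y)"

definition qint :: "nat \<Rightarrow> nat \<Rightarrow> rat" where
  "qint q n = ((- of_nat q) ^ n - 1) / ((- of_nat q) - 1)"

definition qfact :: "nat \<Rightarrow> nat \<Rightarrow> rat" where
  "qfact q k = (\<Prod>i\<in>{1..k}. qint q i)"

definition qbinom_poly :: "nat \<Rightarrow> nat \<Rightarrow> rat poly" where
  "qbinom_poly q k = smult (1 / ((- of_nat q) ^ (k * (k - 1) div 2) * qfact q k))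
                           (\<Prod>i<k. [: - qint q i, 1 :])"

definition laurent_int :: "nat \<Rightarrow> rat \<Rightarrow> bool" where
  "laurent_int q c \<longleftrightarrow> (\<exists>(a::int) (m::nat). c = of_int a / of_nat q ^ m)"

definition R_minus_q :: "nat \<Rightarrow> rat poly set" where
  "R_minus_q q = {p. \<exists>(K::nat) (c::nat \<Rightarrow> rat). (\<forall>k. laurent_int q (c k)) \<and>
                       p = (\<Sum>k<K. smult (c k) (qbinom_poly q k))}"

end

theory Submission
  imports Defs "Jordan_Normal_Form.Determinant"
begin

text \<open>
  An element \<open>x\<close> of \<open>U\<^sub>n\<close> whose \<open>x - 1\<close> has image in the span of the independent columns of
  \<open>A\<close> is \<open>1 + A S A\<^sup>*\<close> for a unique matrix \<open>S\<close>, and its modified type depends only on \<open>S\<close> and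
  the Gram matrix \<open>A\<^sup>* A\<close> (Witt's theorem). A factorization \<open>x y = g\<close> is therefore the same as a
  basis \<open>A\<close> of \<open>im (x - 1) + im (y - 1)\<close>, up to change of basis, together with a pair \<open>(S, T)\<close>. The
  size of \<open>A\<close> is bounded in terms of the types of \<open>x\<close> and \<open>y\<close>, so only finitely many data
  \<open>(A\<^sup>* A, S, T)\<close> occur, independently of \<open>n\<close>. For each of them one has to count the \<open>A\<close> with the
  given Gram matrix that extend a basis \<open>A\<^sub>0\<close> of \<open>im (g - 1)\<close>. Adding one column at a time, this
  reduces to counting vectors with given norm and given inner products with \<open>A\<^sub>0\<close>, and that
  number is a polynomial in \<open>(-q)\<^sup>n\<close>.

  Integrality comes for free: the resulting polynomial is integral at \<open>[n]\<close> for all large \<open>n\<close>, which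
  forces it to be \<open>\<int>[1/q]\<close>-valued at all \<open>[n]\<close>, and Newton interpolation puts it in \<open>R\<close>.
\<close>

section \<open>The Frobenius involution\<close>

text \<open>The image of \<open>x - 1\<close> may be degenerate for the hermitian form, so no
  orthogonal complement can be split off when vectors are counted. What replaces it is a comparison
  over all possible inner products with \<open>A\<close>: radical vectors of the span make the norm
  equidistributed, the remaining inner products only translate it, and the count over the whole
  space is known. The base \<open>-q\<close> comes from the norm \<open>x * \<sigma> x\<close>,
  which takes the value 0 once and every nonzero value of \<open>Fq\<close> exactly
  \<open>q + 1\<close> times: in the difference between the numbers of vectors of norm 0 and of norm
  1, each further coordinate contributes the factor \<open>1 - (q + 1)\<close>. Bases are counted
  instead of subspaces, so the final formula divides by the orders of general linear groups. Its
  coefficients are a priori only rational, which is why integrality is read off from values and not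
  from the formula.\<close>

lemma CHAR_dvd_card_field: "CHAR('k::{finite,field}) dvd card (UNIV :: 'k set)"
proof -
  have "(\<Sum>x\<in>UNIV. x + 1) = (\<Sum>x\<in>UNIV. x :: 'k)"
    by (rule sum.reindex_bij_witness[of _ "\<lambda>x. x - 1" "\<lambda>x. x + 1"]) auto
  then have "of_nat (card (UNIV :: 'k set)) = (0 :: 'k)"
    by (simp add: sum.distrib)
  then show ?thesis
    by (simp add: of_nat_eq_0_iff_char_dvd)
qed

lemma power_card_field: "(x :: 'k::{finite,field}) ^ card (UNIV :: 'k set) = x"
proof (cases "x = 0")
  case False
  have "(\<Prod>y\<in>UNIV - {0}. x * y) = (\<Prod>y\<in>UNIV - {0}. y)"
    by (rule prod.reindex_bij_witness[of _ "\<lambda>y. y / x" "\<lambda>y. x * y"]) (use False in auto)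
  then have "x ^ card (UNIV - {0 :: 'k}) * (\<Prod>y\<in>UNIV - {0}. y) = (\<Prod>y\<in>UNIV - {0}. y)"
    by (simp add: prod.distrib)
  then have "x ^ card (UNIV - {0 :: 'k}) = 1"
    by (simp add: prod_zero_iff)
  moreover have "card (UNIV :: 'k set) = Suc (card (UNIV - {0 :: 'k}))"
    by (simp add: card_Diff_singleton card_gt_0_iff Suc_diff_1)
  ultimately show ?thesis
    by (simp only: power_Suc mult_1_right)
qed (auto simp: power_0_left card_gt_0_iff)

locale hermitian_field =
  fixes q :: nat and K :: "'k::{finite,field} itself"
  assumes prime_power: "\<exists>p k. prime p \<and> k \<ge> 1 \<and> q = p ^ k"
    and card_field: "card (UNIV :: 'k set) = q ^ 2"
begin

abbreviation \<sigma> :: "'k \<Rightarrow> 'k" where "\<sigma> \<equiv> frob q"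

definition Fq :: "'k set" where "Fq = {x. \<sigma> x = x}"

lemma q_gt_1: "q > 1"
proof -
  obtain p k where "prime p" "k \<ge> 1" "q = p ^ k"
    using prime_power by blast
  then show ?thesis
    using prime_gt_1_nat[of p] by (metis One_nat_def one_less_power Suc_le_lessD)
qed

lemma frob_add [simp]: "\<sigma> (x + y) = \<sigma> x + \<sigma> y"
proof -
  obtain p k where pk: "prime p" "k \<ge> 1" "q = p ^ k"
    using prime_power by blast
  have "CHAR('k) > 0"
    by (simp add: finite_imp_CHAR_pos)
  then have pc: "prime CHAR('k)"
    using prime_CHAR_semidom by blast
  \<comment> \<open>The characteristic is the \<open>p\<close> of \<open>q\<close>, being a prime
    that divides a power of \<open>p\<close>; this lets the freshman's dream apply to the exponent
    \<open>q\<close>.\<close>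
  have "CHAR('k) dvd p ^ (k * 2)"
    using CHAR_dvd_card_field[where 'k = 'k] card_field pk(3) by (simp add: power_mult)
  then have "CHAR('k) = p"
    using pc pk(1) by (metis prime_dvd_power primes_dvd_imp_eq)
  then show ?thesis
    using freshmans_dream'[where 'a = 'k, of q k x y] pc pk(3) by (simp add: frob_def)
qed

lemma frob_mult [simp]: "\<sigma> (x * y) = \<sigma> x * \<sigma> y"
  by (simp add: frob_def power_mult_distrib)

lemma frob_0 [simp]: "\<sigma> 0 = 0"
  using q_gt_1 by (simp add: frob_def)

lemma frob_1 [simp]: "\<sigma> 1 = 1"
  by (simp add: frob_def)

lemma frob_frob [simp]: "\<sigma> (\<sigma> x) = x"
  using power_card_field[of x] card_field
  by (simp add: frob_def power2_eq_square flip: power_mult)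

lemma frob_uminus [simp]: "\<sigma> (- x) = - \<sigma> x"
  by (metis add.right_inverse frob_0 frob_add neg_eq_iff_add_eq_0)

lemma frob_diff [simp]: "\<sigma> (x - y) = \<sigma> x - \<sigma> y"
  by (metis add_diff_cancel diff_add_cancel frob_add)

lemma frob_eq_0_iff [simp]: "\<sigma> x = 0 \<longleftrightarrow> x = 0"
  by (metis frob_0 frob_frob)

lemma frob_sum [simp]: "\<sigma> (sum f A) = (\<Sum>a\<in>A. \<sigma> (f a))"
  by (induction A rule: infinite_finite_induct) auto

lemma Fq_iff: "x \<in> Fq \<longleftrightarrow> \<sigma> x = x"
  by (simp add: Fq_def)

text \<open>Both claims drop out of one saturated count. The polynomials \<open>x ^ q - x\<close>
  and \<open>x ^ q + x - h\<close> have at most \<open>q\<close> roots, so the trace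
  \<open>x + \<sigma> x\<close> sends \<open>q ^ 2\<close> elements to at most \<open>q\<close>
  values with at most \<open>q\<close> preimages each; equality must hold throughout.\<close>

lemma card_Fq_and_trace_fibre:
  "card Fq = q" "h \<in> Fq \<Longrightarrow> card {x. x + \<sigma> x = h} = q"
proof -
  have le: "card {x. poly P x = (0::'k)} \<le> q" if "degree P = q" for P
  proof -
    have "P \<noteq> 0"
      using that q_gt_1 by auto
    then show ?thesis
      using card_poly_roots_bound[of P] that by simp
  qed
  have "{x. \<sigma> x = x} = {x. poly (monom 1 q + [:0, -1:]) x = 0}"
    by (auto simp: frob_def poly_monom)
  moreover have "degree (monom 1 q + [:0, -1:] :: 'k poly) = q"
    using q_gt_1 by (subst degree_add_eq_left) (auto simp: degree_monom_eq)
  ultimately have Fq_le: "card Fq \<le> q"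
    using le unfolding Fq_def by metis
  have tr_le: "card {x. x + \<sigma> x = h} \<le> q" for h
  proof -
    have "{x. x + \<sigma> x = h} = {x. poly (monom 1 q + [:-h, 1:]) x = 0}"
      by (auto simp: frob_def poly_monom algebra_simps)
    moreover have "degree (monom 1 q + [:-h, 1:] :: 'k poly) = q"
      using q_gt_1 by (subst degree_add_eq_left) (auto simp: degree_monom_eq)
    ultimately show ?thesis
      using le by metis
  qed
  have "q ^ 2 = (\<Sum>h\<in>Fq. card {x. x + \<sigma> x = h})"
  proof -
    have "(\<Sum>h\<in>Fq. \<Sum>x\<in>{x\<in>UNIV. x + \<sigma> x = h}. 1) = (\<Sum>x\<in>(UNIV :: 'k set). 1::nat)"
      by (rule sum.group) (auto simp: Fq_iff add.commute)
    then show ?thesis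
      by (simp add: card_field)
  qed
  moreover have "\<dots> \<le> (\<Sum>h\<in>Fq. q)"
    by (intro sum_mono tr_le)
  moreover have "(\<Sum>h\<in>Fq. q) \<le> q ^ 2"
    using Fq_le by (simp add: power2_eq_square)
  ultimately have "(\<Sum>h\<in>Fq. card {x. x + \<sigma> x = h}) = (\<Sum>h\<in>Fq. q) \<and> (\<Sum>h\<in>Fq. q) = q ^ 2"
    by linarith
  then have eq: "(\<Sum>h\<in>Fq. card {x. x + \<sigma> x = h}) = (\<Sum>h\<in>Fq. q)" "card Fq * q = q ^ 2"
    by simp_all
  show "card Fq = q"
    using eq(2) q_gt_1 by (simp add: power2_eq_square)
  show "card {x. x + \<sigma> x = h} = q" if "h \<in> Fq"
    using sum_mono_inv[OF eq(1) tr_le that] by simp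
qed

text \<open>The same saturation for the norm: \<open>q ^ 2 - 1\<close> nonzero elements,
  \<open>q - 1\<close> nonzero values, and at most \<open>q + 1\<close> roots of
  \<open>x ^ (q + 1) - h\<close>.\<close>

lemma card_norm_fibre:
  assumes "h \<in> Fq"
  shows "card {x. x * \<sigma> x = h} = (if h = 0 then 1 else q + 1)"
proof -
  have nm_le: "card {x. x * \<sigma> x = h} \<le> q + 1" for h
  proof -
    have "{x. x * \<sigma> x = h} = {x. poly (monom 1 (q + 1) + [:-h:]) x = 0}"
      by (auto simp: frob_def poly_monom algebra_simps)
    moreover have d: "degree (monom 1 (q + 1) + [:-h:] :: 'k poly) = q + 1"
      by (subst degree_add_eq_left) (auto simp: degree_monom_eq)
    moreover have "(monom 1 (q + 1) + [:-h:] :: 'k poly) \<noteq> 0"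
      using d by (metis Zero_not_Suc Suc_eq_plus1 degree_0)
    ultimately show ?thesis
      using card_poly_roots_bound[of "monom 1 (q + 1) + [:-h:] :: 'k poly"] by simp
  qed
  have "q ^ 2 - 1 = (\<Sum>h\<in>Fq - {0}. card {x. x * \<sigma> x = h})"
  proof -
    have "(\<Sum>h\<in>Fq - {0}. \<Sum>x\<in>{x\<in>UNIV - {0}. x * \<sigma> x = h}. 1) = (\<Sum>x\<in>(UNIV - {0} :: 'k set). 1::nat)"
      by (rule sum.group) (auto simp: Fq_iff mult.commute)
    moreover have "{x\<in>UNIV - {0}. x * \<sigma> x = h} = {x. x * \<sigma> x = h}" if "h \<in> Fq - {0}" for h
      using that by auto
    ultimately show ?thesis
      by (simp add: card_field)
  qed
  moreover have "\<dots> \<le> (\<Sum>h\<in>Fq - {0}. q + 1)"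
    by (intro sum_mono nm_le)
  moreover have "(\<Sum>h\<in>Fq - {0}. q + 1) = (q - 1) * (q + 1)"
    using card_Fq_and_trace_fibre(1) by (simp add: Fq_iff)
  moreover have "(q - 1) * (q + 1) = q ^ 2 - 1"
    using q_gt_1 by (simp add: power2_eq_square algebra_simps diff_mult_distrib2)
  ultimately have eq: "(\<Sum>h\<in>Fq - {0}. card {x. x * \<sigma> x = h}) = (\<Sum>h\<in>Fq - {0}. q + 1)"
    by linarith
  show ?thesis
  proof (cases "h = 0")
    case False
    then show ?thesis
      using sum_mono_inv[OF eq nm_le] assms by simp
  qed simp
qed

end

section \<open>Matrices with a left inverse\<close>

lemma mat_mult_assoc:
  "dim_col A = dim_row B \<Longrightarrow> dim_col B = dim_row C \<Longrightarrow> (A * B) * C = A * (B * (C :: 'a::semiring_0 mat))"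
  by (rule assoc_mult_mat[of A "dim_row A" "dim_row B" B "dim_row C" C "dim_col C"]) auto

lemma mat_mult_add:
  "dim_col A = dim_row B \<Longrightarrow> dim_row B = dim_row C \<Longrightarrow> dim_col B = dim_col C \<Longrightarrow>
    A * (B + C) = A * B + A * (C :: 'a::semiring_0 mat)"
  by (rule mult_add_distrib_mat[of A "dim_row A" "dim_row B" B "dim_col C" C]) auto

lemma mat_add_mult:
  "dim_row A = dim_row B \<Longrightarrow> dim_col A = dim_row C \<Longrightarrow> dim_col B = dim_row C \<Longrightarrow>
    (A + B) * C = A * C + B * (C :: 'a::semiring_0 mat)"
  by (rule add_mult_distrib_mat[of A "dim_row B" "dim_row C" B C "dim_col C"]) auto

lemma mat_mult_minus:
  "dim_col A = dim_row B \<Longrightarrow> dim_row B = dim_row C \<Longrightarrow> dim_col B = dim_col C \<Longrightarrow>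
    A * (B - C) = A * B - A * (C :: 'a::ring mat)"
  by (rule mult_minus_distrib_mat[of A "dim_row A" "dim_row B" B "dim_col C" C]) auto

lemma mat_minus_mult:
  "dim_row A = dim_row B \<Longrightarrow> dim_col A = dim_row C \<Longrightarrow> dim_col B = dim_row C \<Longrightarrow>
    (A - B) * C = A * C - B * (C :: 'a::ring mat)"
  by (rule minus_mult_distrib_mat[of A "dim_row B" "dim_row C" B C "dim_col C"]) auto

lemma mat_left_cancel:
  assumes "L * A = 1\<^sub>m d" "dim_col L = dim_row A" "dim_row X = d"
  shows "L * (A * X) = (X :: 'a::semiring_1 mat)"
proof -
  have "dim_col A = d"
    using assms(1) by (metis index_mult_mat(3) index_one_mat(3))
  then show ?thesis
    using assms by (simp flip: mat_mult_assoc)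
qed

lemma mat_diff_eq_0:
  assumes "A - B = 0\<^sub>m n m" "dim_row A = n" "dim_col A = m" "dim_row B = n" "dim_col B = m"
  shows "A = (B :: 'a::group_add mat)"
proof (rule eq_matI)
  fix i j
  assume "i < dim_row B" "j < dim_col B"
  then show "A $$ (i, j) = B $$ (i, j)"
    using arg_cong[OF assms(1), of "\<lambda>M. M $$ (i, j)"] assms(2-) by simp
qed (use assms in auto)

lemma mat_minus_zero [simp]:
  "dim_row A = n \<Longrightarrow> dim_col A = m \<Longrightarrow> A - 0\<^sub>m n m = (A :: 'a::group_add mat)"
  by (rule eq_matI) auto

text \<open>Linear independence of the columns, encoded by a left inverse so that it can be handled
  by matrix identities alone.\<close>

definition linj :: "nat \<Rightarrow> nat \<Rightarrow> 'a::field mat \<Rightarrow> bool" where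
  "linj n d A \<longleftrightarrow> A \<in> carrier_mat n d \<and> (\<exists>L\<in>carrier_mat d n. L * A = 1\<^sub>m d)"

definition hcat :: "'a mat \<Rightarrow> 'a mat \<Rightarrow> 'a mat" where
  "hcat A B = mat (dim_row A) (dim_col A + dim_col B)
     (\<lambda>(i, j). if j < dim_col A then A $$ (i, j) else B $$ (i, j - dim_col A))"

definition vcat :: "'a mat \<Rightarrow> 'a mat \<Rightarrow> 'a mat" where
  "vcat A B = mat (dim_row A + dim_row B) (dim_col A)
     (\<lambda>(i, j). if i < dim_row A then A $$ (i, j) else B $$ (i - dim_row A, j))"

lemma dim_hcat [simp]: "dim_row (hcat A B) = dim_row A" "dim_col (hcat A B) = dim_col A + dim_col B"
  by (simp_all add: hcat_def)

lemma dim_vcat [simp]: "dim_row (vcat A B) = dim_row A + dim_row B" "dim_col (vcat A B) = dim_col A"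
  by (simp_all add: vcat_def)

lemma hcat_carrier:
  "A \<in> carrier_mat n a \<Longrightarrow> B \<in> carrier_mat n b \<Longrightarrow> hcat A B \<in> carrier_mat n (a + b)"
  by (auto simp: hcat_def)

lemma vcat_carrier:
  "A \<in> carrier_mat a n \<Longrightarrow> B \<in> carrier_mat b n \<Longrightarrow> vcat A B \<in> carrier_mat (a + b) n"
  by (auto simp: vcat_def)

lemma mult_hcat:
  "dim_col M = dim_row A \<Longrightarrow> dim_row A = dim_row B \<Longrightarrow> M * hcat A B = hcat (M * A) (M * B)"
  by (rule eq_matI) (auto simp: hcat_def scalar_prod_def intro!: sum.cong)

lemma vcat_mult:
  "dim_col P = dim_row M \<Longrightarrow> dim_col Q = dim_row M \<Longrightarrow> vcat P Q * M = vcat (P * M) (Q * M)"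
  by (rule eq_matI) (auto simp: vcat_def scalar_prod_def intro!: sum.cong)

lemma hcat_vcat_mult:
  assumes "dim_row A = dim_row B" "dim_col A = dim_row P" "dim_col B = dim_row Q" "dim_col P = dim_col Q"
  shows "hcat A B * vcat P Q = A * P + B * (Q :: 'a::semiring_0 mat)"
proof (rule eq_matI)
  fix i j
  assume "i < dim_row (A * P + B * Q)" "j < dim_col (A * P + B * Q)"
  then have ij: "i < dim_row B" "j < dim_col Q"
    by auto
  let ?a = "dim_row P" and ?b = "dim_row Q"
  have "(hcat A B * vcat P Q) $$ (i, j) =
      (\<Sum>k = 0..<?a + ?b. (if k < ?a then A $$ (i, k) else B $$ (i, k - ?a)) *
         (if k < ?a then P $$ (k, j) else Q $$ (k - ?a, j)))"
    using ij assms by (auto simp: hcat_def vcat_def scalar_prod_def intro!: sum.cong)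
  also have "\<dots> = (\<Sum>k = 0..<?a. A $$ (i, k) * P $$ (k, j)) + (\<Sum>k = ?a..<?a + ?b. B $$ (i, k - ?a) * Q $$ (k - ?a, j))"
    by (subst sum.atLeastLessThan_concat[of 0 ?a, symmetric]) (auto intro!: arg_cong2[of _ _ _ _ "(+)"] sum.cong)
  also have "(\<Sum>k = ?a..<?a + ?b. B $$ (i, k - ?a) * Q $$ (k - ?a, j)) = (\<Sum>k = 0..<?b. B $$ (i, k) * Q $$ (k, j))"
    by (rule sum.reindex_bij_witness[of _ "\<lambda>k. k + ?a" "\<lambda>k. k - ?a"]) auto
  finally show "(hcat A B * vcat P Q) $$ (i, j) = (A * P + B * Q) $$ (i, j)"
    using ij assms by (simp add: scalar_prod_def)
qed (use assms in auto)

lemma hcat_eq_iff: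
  assumes "dim_row A = n" "dim_row B = n" "dim_row A' = n" "dim_row B' = n"
    "dim_col A = dim_col A'" "dim_col B = dim_col B'"
  shows "hcat A B = hcat A' B' \<longleftrightarrow> A = A' \<and> B = B'"
proof
  assume eq: "hcat A B = hcat A' B'"
  have "A $$ (i, j) = A' $$ (i, j)" if "i < n" "j < dim_col A" for i j
    using arg_cong[OF eq, of "\<lambda>M. M $$ (i, j)"] that assms by (simp add: hcat_def)
  moreover have "B $$ (i, j) = B' $$ (i, j)" if "i < n" "j < dim_col B" for i j
    using arg_cong[OF eq, of "\<lambda>M. M $$ (i, j + dim_col A)"] that assms by (simp add: hcat_def)
  ultimately show "A = A' \<and> B = B'"
    using assms by (auto intro!: eq_matI)
qed auto

lemma vcat_eq_iff:
  assumes "dim_col A = n" "dim_col B = n" "dim_col A' = n" "dim_col B' = n"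
    "dim_row A = dim_row A'" "dim_row B = dim_row B'"
  shows "vcat A B = vcat A' B' \<longleftrightarrow> A = A' \<and> B = B'"
proof
  assume eq: "vcat A B = vcat A' B'"
  have "A $$ (i, j) = A' $$ (i, j)" if "j < n" "i < dim_row A" for i j
    using arg_cong[OF eq, of "\<lambda>M. M $$ (i, j)"] that assms by (simp add: vcat_def)
  moreover have "B $$ (i, j) = B' $$ (i, j)" if "j < n" "i < dim_row B" for i j
    using arg_cong[OF eq, of "\<lambda>M. M $$ (i + dim_row A, j)"] that assms by (simp add: vcat_def)
  ultimately show "A = A' \<and> B = B'"
    using assms by (auto intro!: eq_matI)
qed auto

lemma vcat_split:
  assumes "M \<in> carrier_mat (a + b) c"
  obtains P Q where "P \<in> carrier_mat a c" "Q \<in> carrier_mat b c" "M = vcat P Q"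
proof
  show "M = vcat (mat a c (\<lambda>(i, j). M $$ (i, j))) (mat b c (\<lambda>(i, j). M $$ (i + a, j)))"
    using assms by (auto intro!: eq_matI simp: vcat_def)
qed auto

lemma one_mat_blocks: "1\<^sub>m (a + b) = vcat (hcat (1\<^sub>m a) (0\<^sub>m a b)) (hcat (0\<^sub>m b a) (1\<^sub>m b))"
  by (rule eq_matI) (auto simp: vcat_def hcat_def)

lemma linj_carrier: "linj n d A \<Longrightarrow> A \<in> carrier_mat n d"
  by (simp add: linj_def)

lemma linj_cancel:
  assumes "linj n d A" "X \<in> carrier_mat d m" "Y \<in> carrier_mat d m" "A * X = A * Y"
  shows "X = Y"
  using assms unfolding linj_def by (metis carrier_matD mat_left_cancel)

lemma linj_mult:
  assumes "linj n d A" "linj d e B"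
  shows "linj n e (A * B)"
proof -
  obtain L M where LM: "L \<in> carrier_mat d n" "L * A = 1\<^sub>m d" "M \<in> carrier_mat e d" "M * B = 1\<^sub>m e"
    using assms by (auto simp: linj_def)
  have "(M * L) * (A * B) = 1\<^sub>m e"
    using LM assms[THEN linj_carrier] by (simp add: mat_mult_assoc mat_left_cancel)
  then show ?thesis
    using LM assms[THEN linj_carrier] by (auto simp: linj_def intro!: bexI[of _ "M * L"])
qed

lemma linj_right_factor:
  assumes "linj n e (A * B)" "A \<in> carrier_mat n d" "B \<in> carrier_mat d e"
  shows "linj d e B"
proof -
  obtain L where "L \<in> carrier_mat e n" "L * (A * B) = 1\<^sub>m e"
    using assms by (auto simp: linj_def)
  then show ?thesis
    using assms by (auto simp: linj_def mat_mult_assoc intro!: bexI[of _ "L * A"])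
qed

text \<open>\<open>E = 1 - A * L\<close> annihilates the columns of \<open>A\<close> but not
  \<open>c\<close>, so a rescaled row \<open>w\<close> of \<open>E\<close> is a functional with
  \<open>w * A = 0\<close> and \<open>w * c = 1\<close>. Correcting \<open>L\<close> by
  \<open>w\<close> makes it vanish on \<open>c\<close>, and stacking both gives the left
  inverse.\<close>

lemma linj_hcat:
  assumes A: "linj n e A" and c: "c \<in> carrier_mat n 1"
    and notin: "\<And>v. v \<in> carrier_mat e 1 \<Longrightarrow> A * v \<noteq> c"
  shows "linj n (e + 1) (hcat A c)"
proof -
  obtain L where L: "L \<in> carrier_mat e n" "L * A = 1\<^sub>m e"
    using A by (auto simp: linj_def)
  note Ac = linj_carrier[OF A]
  define E where "E = 1\<^sub>m n - A * L"
  have E: "E \<in> carrier_mat n n"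
    using Ac L by (auto simp: E_def)
  have EA: "E * A = 0\<^sub>m n e"
    using Ac L by (simp add: E_def mat_minus_mult mat_mult_assoc)
  have "E * c \<noteq> 0\<^sub>m n 1"
  proof
    assume "E * c = 0\<^sub>m n 1"
    then have "c - A * (L * c) = 0\<^sub>m n 1"
      using Ac L c by (simp add: E_def mat_minus_mult mat_mult_assoc)
    then have "A * (L * c) = c"
      using Ac L c mat_diff_eq_0[of c "A * (L * c)" n 1] by simp
    then show False
      using notin[of "L * c"] L c by auto
  qed
  moreover have "E * c = 0\<^sub>m n 1" if "\<forall>i<n. (E * c) $$ (i, 0) = 0"
    using that E c by (intro eq_matI) auto
  ultimately obtain i where i: "i < n" "(E * c) $$ (i, 0) \<noteq> 0"
    by blast
  define w where "w = mat 1 n (\<lambda>(_, j). E $$ (i, j) / (E * c) $$ (i, 0))"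
  have w: "w \<in> carrier_mat 1 n"
    by (simp add: w_def)
  have wM: "w * M = mat 1 (dim_col M) (\<lambda>(_, j). (E * M) $$ (i, j) / (E * c) $$ (i, 0))"
    if "dim_row M = n" for M
    using that E i(1) unfolding w_def
    by (intro eq_matI) (auto simp: scalar_prod_def sum_divide_distrib intro!: sum.cong)
  have wA: "w * A = 0\<^sub>m 1 e"
    using Ac i(1) by (simp add: wM EA) (auto intro!: eq_matI)
  have wc: "w * c = 1\<^sub>m 1"
    using c i(2) by (subst wM) (auto intro!: eq_matI simp del: index_mult_mat)
  let ?L' = "vcat (L - L * c * w) w"
  have "?L' * hcat A c = vcat (hcat ((L - L * c * w) * A) ((L - L * c * w) * c)) (hcat (w * A) (w * c))"
    using L c w Ac by (subst vcat_mult) (simp_all add: mult_hcat)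
  also have "(L - L * c * w) * A = 1\<^sub>m e"
    using L c w Ac wA by (simp add: mat_minus_mult mat_mult_assoc)
  also have "(L - L * c * w) * c = 0\<^sub>m e 1"
    using L c w Ac wc by (simp add: mat_minus_mult mat_mult_assoc)
  finally have "?L' * hcat A c = 1\<^sub>m (e + 1)"
    by (simp only: wA wc one_mat_blocks)
  then show ?thesis
    using L w c Ac by (auto simp: linj_def intro!: bexI[of _ ?L'])
qed

lemma card_carrier_mat: "card (carrier_mat n m :: 'a::finite mat set) = card (UNIV :: 'a set) ^ (n * m)"
proof -
  let ?I = "{..<n} \<times> {..<m}"
  have "bij_betw (\<lambda>M. restrict (\<lambda>ij. M $$ ij) ?I) (carrier_mat n m) (?I \<rightarrow>\<^sub>E (UNIV :: 'a set))"
  proof (rule bij_betwI[where g = "mat n m"])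
    show "mat n m (restrict (\<lambda>ij. M $$ ij) ?I) = M" if "M \<in> carrier_mat n m" for M :: "'a mat"
      using that by (intro eq_matI) auto
    show "restrict (\<lambda>ij. mat n m f $$ ij) ?I = f" if "f \<in> ?I \<rightarrow>\<^sub>E (UNIV :: 'a set)" for f
    proof
      show "restrict (\<lambda>ij. mat n m f $$ ij) ?I x = f x" for x
        using PiE_arb[OF that, of x] by (cases x) (simp add: restrict_def)
    qed
  qed simp_all
  then have "card (carrier_mat n m :: 'a mat set) = card (?I \<rightarrow>\<^sub>E (UNIV :: 'a set))"
    by (rule bij_betw_same_card)
  then show ?thesis
    by (simp add: card_PiE card_cartesian_product)
qed

lemma finite_carrier_mat [simp]: "finite (carrier_mat n m :: 'a::finite mat set)"
  by (rule card_ge_0_finite) (simp add: card_carrier_mat card_gt_0_iff)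

lemma card_gt_1_field: "card (UNIV :: 'a::{finite,field} set) > 1"
  using card_mono[of UNIV "{0, 1 :: 'a}"] by simp

text \<open>\<open>C\<close> embeds \<open>carrier_mat r 1\<close> into
  \<open>carrier_mat s 1\<close>; over a finite field, counting both sets stands in for dimension
  theory.\<close>

lemma left_inverse_dim_le:
  fixes B C :: "'a::{finite,field} mat"
  assumes "B \<in> carrier_mat r s" "C \<in> carrier_mat s r" "B * C = 1\<^sub>m r"
  shows "r \<le> s"
proof -
  have "inj_on (\<lambda>v. C * v) (carrier_mat r 1)"
    using assms by (intro inj_onI) (metis carrier_matD mat_left_cancel)
  moreover have "(\<lambda>v. C * v) ` carrier_mat r 1 \<subseteq> carrier_mat s 1"
    using assms by auto
  ultimately have "card (carrier_mat r 1 :: 'a mat set) \<le> card (carrier_mat s 1 :: 'a mat set)"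
    by (intro card_inj_on_le) auto
  then show ?thesis
    using card_gt_1_field[where 'a = 'a] by (simp add: card_carrier_mat)
qed

lemma linj_dim_le: "linj n d (A :: 'a::{finite,field} mat) \<Longrightarrow> d \<le> n"
  unfolding linj_def using left_inverse_dim_le by blast

lemma linj_square:
  assumes "linj n n A"
  obtains L where "L \<in> carrier_mat n n" "L * A = 1\<^sub>m n" "A * L = 1\<^sub>m n"
proof -
  obtain L where "L \<in> carrier_mat n n" "L * A = 1\<^sub>m n" and A: "A \<in> carrier_mat n n"
    using assms by (auto simp: linj_def)
  then show ?thesis
    using that mat_mult_left_right_inverse[of L n A] by blast
qed

lemma linj_not_surj:
  assumes A: "linj d e (A :: 'a::{finite,field} mat)" and "e < d"
  obtains v where "v \<in> carrier_mat d 1" "\<And>u. u \<in> carrier_mat e 1 \<Longrightarrow> A * u \<noteq> v"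
proof -
  have "card ((\<lambda>u. A * u) ` carrier_mat e 1) \<le> card (carrier_mat e 1 :: 'a mat set)"
    by (rule card_image_le) simp
  also have "\<dots> < card (carrier_mat d 1 :: 'a mat set)"
    using \<open>e < d\<close> card_gt_1_field[where 'a = 'a] by (simp add: card_carrier_mat)
  finally have "\<not> carrier_mat d 1 \<subseteq> (\<lambda>u. A * u) ` carrier_mat e 1"
    by (metis card_mono finite_carrier_mat finite_imageI not_le)
  then show ?thesis
    using that by blast
qed

lemma mat_of_columns_solution:
  assumes "A \<in> carrier_mat n r" "M \<in> carrier_mat n m"
    and "\<And>j. j < m \<Longrightarrow> \<exists>v\<in>carrier_mat r 1. A * v = mat n 1 (\<lambda>(i, _). M $$ (i, j))"
  obtains X where "X \<in> carrier_mat r m" "A * X = M"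
proof -
  obtain v where v: "\<And>j. j < m \<Longrightarrow> v j \<in> carrier_mat r 1 \<and> A * v j = mat n 1 (\<lambda>(i, _). M $$ (i, j))"
    using assms(3) by metis
  let ?X = "mat r m (\<lambda>(i, j). v j $$ (i, 0))"
  have "A * ?X = M"
  proof (rule eq_matI)
    fix i j
    assume "i < dim_row M" "j < dim_col M"
    then have ij: "i < n" "j < m"
      using assms by auto
    have "v j \<in> carrier_mat r 1"
      using v ij by blast
    then have "(A * ?X) $$ (i, j) = (A * v j) $$ (i, 0)"
      using ij assms(1) by (auto simp: scalar_prod_def)
    then show "(A * ?X) $$ (i, j) = M $$ (i, j)"
      using v[of j] ij by simp
  qed (use assms in auto)
  then show ?thesis
    using that[of ?X] by simp
qed

text \<open>A maximal injective \<open>M * K\<close> spans the column space of \<open>M\<close>.\<close>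

lemma rank_factorization:
  fixes M :: "'a::{finite,field} mat"
  assumes M: "M \<in> carrier_mat n m"
  obtains r K X where "K \<in> carrier_mat m r" "linj n r (M * K)" "X \<in> carrier_mat r m" "M = M * K * X"
proof -
  define P where "P r \<longleftrightarrow> (\<exists>K\<in>carrier_mat m r. linj n r (M * K))" for r
  have "P 0"
  proof -
    have "0\<^sub>m 0 n * (M * 0\<^sub>m m 0) = 1\<^sub>m 0"
      by (rule eq_matI) auto
    then have "linj n 0 (M * 0\<^sub>m m 0)"
      using M unfolding linj_def by (metis mult_carrier_mat zero_carrier_mat)
    then show ?thesis
      unfolding P_def by (metis zero_carrier_mat)
  qed
  moreover have "r \<le> m" if "P r" for r
  proof -
    obtain K where "K \<in> carrier_mat m r" "linj n r (M * K)"
      using \<open>P r\<close> unfolding P_def by blast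
    then show ?thesis
      using linj_dim_le[OF linj_right_factor[OF _ M]] by blast
  qed
  ultimately have "\<exists>d. P d \<and> (\<forall>r. P r \<longrightarrow> r \<le> d)"
    by (intro Nat.ex_has_greatest_nat[of P 0 m]) auto
  then obtain d where d: "P d" and max: "\<And>r. P r \<Longrightarrow> r \<le> d"
    by iprover
  then obtain K where K: "K \<in> carrier_mat m d" "linj n d (M * K)"
    unfolding P_def by blast
  have "\<exists>v\<in>carrier_mat d 1. M * K * v = mat n 1 (\<lambda>(i, _). M $$ (i, j))" if "j < m" for j
  proof (rule ccontr)
    let ?e = "mat m 1 (\<lambda>(i, _). if i = j then 1 else 0 :: 'a)"
    have e: "?e \<in> carrier_mat m 1"
      by simp
    have Me: "M * ?e = mat n 1 (\<lambda>(i, _). M $$ (i, j))"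
      using M that by (intro eq_matI) (auto simp: scalar_prod_def if_distrib cong: if_cong)
    assume neg: "\<not> ?thesis"
    have "linj n (d + 1) (hcat (M * K) (M * ?e))"
      unfolding Me using neg by (intro linj_hcat K) auto
    then have "linj n (d + 1) (M * hcat K ?e)"
      using K(1) M by (simp add: mult_hcat)
    then have "P (d + 1)"
      unfolding P_def using hcat_carrier[OF K(1) e] by blast
    then show False
      using max by fastforce
  qed
  then obtain X where "X \<in> carrier_mat d m" "M * K * X = M"
    using mat_of_columns_solution[of "M * K" n d M m] K M by (metis mult_carrier_mat)
  then show ?thesis
    using that K by metis
qed

section \<open>Vectors of prescribed norm\<close>

lemma mat_minus_add_cancel:
  "c \<in> carrier_mat n m \<Longrightarrow> d \<in> carrier_mat n m \<Longrightarrow> c - d + d = (c :: 'a::group_add mat)"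
  by (rule eq_matI) auto

lemma mat_add_minus_cancel:
  "c \<in> carrier_mat n m \<Longrightarrow> d \<in> carrier_mat n m \<Longrightarrow> c + d - d = (c :: 'a::group_add mat)"
  by (rule eq_matI) auto

lemma smult_zero_mat [simp]: "t \<cdot>\<^sub>m 0\<^sub>m n m = (0\<^sub>m n m :: 'a::semiring_0 mat)"
  by (rule eq_matI) auto

context hermitian_field
begin

section \<open>The conjugate transpose, the unitary group and norms of column vectors\<close>

definition adj :: "'k mat \<Rightarrow> 'k mat" where
  "adj A = mat (dim_col A) (dim_row A) (\<lambda>(i, j). \<sigma> (A $$ (j, i)))"

lemma dim_adj [simp]: "dim_row (adj A) = dim_col A" "dim_col (adj A) = dim_row A"
  by (simp_all add: adj_def)

lemma index_adj [simp]: "i < dim_col A \<Longrightarrow> j < dim_row A \<Longrightarrow> adj A $$ (i, j) = \<sigma> (A $$ (j, i))"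
  by (simp add: adj_def)

lemma adj_carrier [simp]: "adj A \<in> carrier_mat n m \<longleftrightarrow> A \<in> carrier_mat m n"
  using carrier_matI[of "adj A" n m] carrier_matI[of A m n] by fastforce

lemma adj_adj [simp]: "adj (adj A) = A"
  by (rule eq_matI) auto

lemma adj_mult: "dim_col A = dim_row B \<Longrightarrow> adj (A * B) = adj B * adj A"
  by (rule eq_matI) (auto simp: scalar_prod_def mult.commute intro!: sum.cong)

lemma adj_add: "dim_row A = dim_row B \<Longrightarrow> dim_col A = dim_col B \<Longrightarrow> adj (A + B) = adj A + adj B"
  by (rule eq_matI) auto

lemma adj_minus: "dim_row A = dim_row B \<Longrightarrow> dim_col A = dim_col B \<Longrightarrow> adj (A - B) = adj A - adj B"
  by (rule eq_matI) auto

lemma adj_one [simp]: "adj (1\<^sub>m n) = 1\<^sub>m n"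
  by (rule eq_matI) auto

lemma adj_zero [simp]: "adj (0\<^sub>m n m) = 0\<^sub>m m n"
  by (rule eq_matI) auto

lemma adj_eq_iff: "adj A = adj B \<longleftrightarrow> A = B"
  by (metis adj_adj)

text \<open>\<open>adj g * g\<close> is the transpose of
  \<open>transpose_mat g * map_mat \<sigma> g\<close>, so both conditions say the same; the inverse
  in the definition of the group is \<open>adj g\<close>.\<close>

lemma unitary_group_iff:
  "g \<in> unitary_group q n \<longleftrightarrow> g \<in> carrier_mat n n \<and> adj g * g = 1\<^sub>m n"
proof -
  have "adj g * g = 1\<^sub>m n \<longleftrightarrow> transpose_mat g * map_mat \<sigma> g = 1\<^sub>m n"
    if g: "g \<in> carrier_mat n n"
  proof -
    have "adj g * g = transpose_mat (transpose_mat g * map_mat \<sigma> g)"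
      using g by (intro eq_matI) (auto simp: scalar_prod_def mult.commute intro!: sum.cong)
    then show ?thesis
      by (metis transpose_one transpose_transpose)
  qed
  moreover have "\<exists>g'. g * g' = 1\<^sub>m n \<and> g' * g = 1\<^sub>m n"
    if "g \<in> carrier_mat n n" "adj g * g = 1\<^sub>m n"
    using that mat_mult_left_right_inverse[of "adj g" n g] by auto
  ultimately show ?thesis
    unfolding unitary_group_def by blast
qed

lemma unitary_right: "g \<in> unitary_group q n \<Longrightarrow> g * adj g = 1\<^sub>m n"
  using mat_mult_left_right_inverse[of "adj g" n g] by (auto simp: unitary_group_iff)

text \<open>Column vectors are \<open>n \<times> 1\<close> matrices, so scalars are read off at position \<open>(0, 0)\<close>.\<close>

definition nrm :: "'k mat \<Rightarrow> 'k" where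
  "nrm c = (adj c * c) $$ (0, 0)"

definition qform :: "'k mat \<Rightarrow> 'k mat \<Rightarrow> 'k" where
  "qform H v = (adj v * H * v) $$ (0, 0)"

lemma nrm_sum: "c \<in> carrier_mat n 1 \<Longrightarrow> nrm c = (\<Sum>i<n. c $$ (i, 0) * \<sigma> (c $$ (i, 0)))"
  by (simp add: nrm_def scalar_prod_def mult.commute lessThan_atLeast0)

lemma nrm_Fq: "c \<in> carrier_mat n 1 \<Longrightarrow> nrm c \<in> Fq"
  by (simp add: nrm_sum Fq_iff mult.commute)

lemma nrm_smult: "c \<in> carrier_mat n 1 \<Longrightarrow> nrm (t \<cdot>\<^sub>m c) = t * \<sigma> t * nrm c"
  by (simp add: nrm_sum[of _ n] sum_distrib_left mult_ac)

lemma nrm_add: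
  assumes "c \<in> carrier_mat n 1" "d \<in> carrier_mat n 1"
  shows "nrm (c + d) = nrm c + (adj c * d) $$ (0, 0) + \<sigma> ((adj c * d) $$ (0, 0)) + nrm d"
  using assms by (simp add: nrm_sum[of _ n] scalar_prod_def lessThan_atLeast0 algebra_simps flip: sum.distrib)

lemma nrm_mult:
  assumes "A \<in> carrier_mat n e" "v \<in> carrier_mat e 1"
  shows "nrm (A * v) = qform (adj A * A) v"
  using assms by (simp add: nrm_def qform_def adj_mult mat_mult_assoc)

lemma qform_Fq:
  assumes "H \<in> carrier_mat e e" "adj H = H" "v \<in> carrier_mat e 1"
  shows "qform H v \<in> Fq"
proof -
  have "adj (adj v * H * v) = adj v * H * v"
    using assms by (simp add: adj_mult mat_mult_assoc)
  then have "\<sigma> ((adj v * H * v) $$ (0, 0)) = (adj v * H * v) $$ (0, 0)"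
    using assms index_adj[of 0 "adj v * H * v" 0] by simp
  then show ?thesis
    by (simp add: qform_def Fq_iff)
qed

section \<open>Vectors with given inner products and given norm\<close>

definition fibre :: "nat \<Rightarrow> 'k mat \<Rightarrow> 'k mat \<Rightarrow> 'k mat set" where
  "fibre n A b = {c \<in> carrier_mat n 1. adj A * c = b}"

definition nfibre :: "nat \<Rightarrow> 'k mat \<Rightarrow> 'k mat \<Rightarrow> 'k \<Rightarrow> 'k mat set" where
  "nfibre n A b h = {c \<in> fibre n A b. nrm c = h}"

lemma finite_fibre [simp]: "finite (fibre n A b)" "finite (nfibre n A b h)"
  by (simp_all add: fibre_def nfibre_def)

lemma adj_linj_solution:
  assumes "linj n e A" "b \<in> carrier_mat e m"
  obtains c where "c \<in> carrier_mat n m" "adj A * c = b"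
proof -
  obtain L where L: "L \<in> carrier_mat e n" "L * A = 1\<^sub>m e"
    using assms by (auto simp: linj_def)
  have "adj A * adj L = 1\<^sub>m e"
    using L linj_carrier[OF assms(1)] by (metis adj_mult adj_one carrier_matD)
  then have "adj A * (adj L * b) = b"
    using L linj_carrier[OF assms(1)] assms(2) by (intro mat_left_cancel) auto
  then show ?thesis
    using that[of "adj L * b"] L assms by simp
qed

text \<open>The fibres of the linear map given by \<open>adj A\<close> are translates of each other
  by \<open>adj_linj_solution\<close>, hence equal in size, and \<open>q ^ (2 * e)\<close> of them
  partition the whole space.\<close>

lemma card_fibre:
  assumes "linj n e A" "b \<in> carrier_mat e 1"
  shows "card (fibre n A b) * q ^ (2 * e) = q ^ (2 * n)"
proof -
  note A = linj_carrier[OF assms(1)]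
  have fibre_le: "card (fibre n A b) \<le> card (fibre n A b')"
    if b: "b \<in> carrier_mat e 1" "b' \<in> carrier_mat e 1" for b b'
  proof -
    obtain d where d: "d \<in> carrier_mat n 1" "adj A * d = b' - b"
      using adj_linj_solution[OF assms(1), of "b' - b" 1] minus_carrier_mat[OF b(1)] by blast
    show ?thesis
    proof (rule card_inj_on_le)
      show "inj_on (\<lambda>c. c + d) (fibre n A b)"
      proof (rule inj_onI)
        fix c c'
        assume "c \<in> fibre n A b" "c' \<in> fibre n A b" and eq: "c + d = c' + d"
        then have c: "c \<in> carrier_mat n 1" "c' \<in> carrier_mat n 1"
          by (auto simp: fibre_def)
        show "c = c'"
        proof (rule eq_matI)
          fix i j
          assume "i < dim_row c'" "j < dim_col c'"
          then show "c $$ (i, j) = c' $$ (i, j)"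
            using arg_cong[OF eq, of "\<lambda>M. M $$ (i, j)"] c d(1) by simp
        qed (use c in auto)
      qed
      show "(\<lambda>c. c + d) ` fibre n A b \<subseteq> fibre n A b'"
      proof
        fix c'
        assume "c' \<in> (\<lambda>c. c + d) ` fibre n A b"
        then obtain c where c: "c \<in> carrier_mat n 1" "adj A * c = b" "c' = c + d"
          by (auto simp: fibre_def)
        have "adj A * c' = b + (b' - b)"
          using c d A by (simp add: mat_mult_add)
        also have "\<dots> = b'"
          using b by (intro eq_matI) auto
        finally show "c' \<in> fibre n A b'"
          using c d by (simp add: fibre_def)
      qed
    qed simp
  qed
  have "(\<Sum>b'\<in>carrier_mat e 1. card (fibre n A b')) = (\<Sum>b'\<in>carrier_mat e 1. \<Sum>c\<in>{c \<in> carrier_mat n 1. adj A * c = b'}. 1)"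
    by (simp add: fibre_def)
  also have "\<dots> = (\<Sum>c\<in>(carrier_mat n 1 :: 'k mat set). 1)"
    by (rule sum.group) (use A in auto)
  also have "\<dots> = q ^ (2 * n)"
    by (simp add: card_carrier_mat card_field flip: power_mult)
  also have "(\<Sum>b'\<in>carrier_mat e 1. card (fibre n A b')) = (\<Sum>b'\<in>(carrier_mat e 1 :: 'k mat set). card (fibre n A b))"
    using fibre_le assms(2) by (intro sum.cong refl antisym) auto
  finally show ?thesis
    by (simp add: card_carrier_mat card_field mult.commute flip: power_mult)
qed

text \<open>Scaling by \<open>t\<close> preserves orthogonality to \<open>A\<close> and multiplies
  norms by \<open>t * \<sigma> t\<close>, which runs through all nonzero elements of
  \<open>Fq\<close>. For \<open>b = 0\<close> there are thus only two counts, one for norm zero and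
  one for nonzero norms.\<close>

lemma card_nfibre_scale:
  assumes A: "A \<in> carrier_mat n e" and h: "h \<in> Fq" "h \<noteq> 0"
  shows "card (nfibre n A (0\<^sub>m e 1) h) = card (nfibre n A (0\<^sub>m e 1) 1)"
proof -
  have le: "card (nfibre n A (0\<^sub>m e 1) h) \<le> card (nfibre n A (0\<^sub>m e 1) h')"
    if hs: "h \<in> Fq" "h \<noteq> 0" "h' \<in> Fq" "h' \<noteq> 0" for h h'
  proof -
    have "\<sigma> (h' / h) * h = h'"
      using hs frob_mult[of "h' / h" h] by (simp add: Fq_iff)
    then have "h' / h \<in> Fq"
      using hs by (simp add: Fq_iff field_simps)
    then have "card {t. t * \<sigma> t = h' / h} \<noteq> 0"
      using card_norm_fibre by simp
    then obtain t where t: "t * \<sigma> t = h' / h"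
      by (auto simp: card_eq_0_iff)
    with hs have t0: "t \<noteq> 0"
      by auto
    show ?thesis
    proof (rule card_inj_on_le)
      show "inj_on ((\<cdot>\<^sub>m) t) (nfibre n A (0\<^sub>m e 1) h)"
      proof (rule inj_onI)
        fix c c'
        assume "c \<in> nfibre n A (0\<^sub>m e 1) h" "c' \<in> nfibre n A (0\<^sub>m e 1) h"
          and eq: "t \<cdot>\<^sub>m c = t \<cdot>\<^sub>m c'"
        then have c: "c \<in> carrier_mat n 1" "c' \<in> carrier_mat n 1"
          by (auto simp: nfibre_def fibre_def)
        show "c = c'"
        proof (rule eq_matI)
          fix i j
          assume "i < dim_row c'" "j < dim_col c'"
          then show "c $$ (i, j) = c' $$ (i, j)"
            using arg_cong[OF eq, of "\<lambda>M. M $$ (i, j)"] c t0 by simp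
        qed (use c in auto)
      qed
      show "(\<cdot>\<^sub>m) t ` nfibre n A (0\<^sub>m e 1) h \<subseteq> nfibre n A (0\<^sub>m e 1) h'"
        using t hs A by (auto simp: nfibre_def fibre_def nrm_smult mult_smult_distrib[of _ e n])
    qed simp
  qed
  show ?thesis
    using le h by (intro antisym) (auto simp: Fq_iff)
qed

lemma card_fibre_nfibre:
  "card (fibre n A b) = (\<Sum>h\<in>Fq. card (nfibre n A b h))"
proof -
  have "(\<Sum>h\<in>Fq. \<Sum>c\<in>{c \<in> fibre n A b. nrm c = h}. 1) = (\<Sum>c\<in>fibre n A b. 1::nat)"
    by (rule sum.group) (auto simp: fibre_def intro: nrm_Fq)
  then show ?thesis
    by (simp add: nfibre_def)
qed

text \<open>Pythagoras: \<open>A * v\<close> is orthogonal to every \<open>c\<close> with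
  \<open>adj A * c = 0\<close>, so adding it shifts the norm by the constant
  \<open>nrm (A * v)\<close>.\<close>

lemma card_nfibre_translate:
  assumes A: "A \<in> carrier_mat n e" and v: "v \<in> carrier_mat e 1"
  shows "card (nfibre n A (adj A * A * v) h) = card (nfibre n A (0\<^sub>m e 1) (h - qform (adj A * A) v))"
proof -
  have Av: "A * v \<in> carrier_mat n 1"
    using A v by simp
  have nrm1: "nrm (c + A * v) = nrm c + qform (adj A * A) v"
    if "c \<in> carrier_mat n 1" "adj A * c = 0\<^sub>m e 1" for c
  proof -
    have "adj c * A = 0\<^sub>m 1 e"
      using arg_cong[OF that(2), of adj] that(1) A by (simp add: adj_mult)
    then have "adj c * (A * v) = 0\<^sub>m 1 1"
      using that(1) A v by (simp flip: mat_mult_assoc)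
    then show ?thesis
      using nrm_add[OF that(1) Av] nrm_mult[OF A v] by simp
  qed
  have "bij_betw (\<lambda>c. c + A * v) (nfibre n A (0\<^sub>m e 1) (h - qform (adj A * A) v)) (nfibre n A (adj A * A * v) h)"
  proof (rule bij_betwI[where g = "\<lambda>c. c - A * v"])
    show "(\<lambda>c. c + A * v) \<in> nfibre n A (0\<^sub>m e 1) (h - qform (adj A * A) v) \<rightarrow> nfibre n A (adj A * A * v) h"
      using A v by (auto simp: nfibre_def fibre_def nrm1 mat_mult_add mat_mult_assoc)
    show "(\<lambda>c. c - A * v) \<in> nfibre n A (adj A * A * v) h \<rightarrow> nfibre n A (0\<^sub>m e 1) (h - qform (adj A * A) v)"
    proof
      fix c assume "c \<in> nfibre n A (adj A * A * v) h"
      then have c: "c \<in> carrier_mat n 1" "adj A * c = adj A * A * v" "nrm c = h"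
        by (auto simp: nfibre_def fibre_def)
      have z: "adj A * (c - A * v) = 0\<^sub>m e 1"
        using c A v by (simp add: mat_mult_minus mat_mult_assoc)
      have "c - A * v + A * v = c"
        using c(1) Av by (rule mat_minus_add_cancel)
      then have "nrm c = nrm (c - A * v) + qform (adj A * A) v"
        using nrm1[OF _ z] c(1) Av by (simp add: minus_carrier_mat)
      then show "c - A * v \<in> nfibre n A (0\<^sub>m e 1) (h - qform (adj A * A) v)"
        using z c Av by (simp add: nfibre_def fibre_def minus_carrier_mat)
    qed
    show "c + A * v - A * v = c" if "c \<in> nfibre n A (0\<^sub>m e 1) (h - qform (adj A * A) v)" for c
      using that mat_add_minus_cancel[OF _ Av] by (simp add: nfibre_def fibre_def)
    show "c - A * v + A * v = c" if "c \<in> nfibre n A (adj A * A * v) h" for c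
      using that mat_minus_add_cancel[OF _ Av] by (simp add: nfibre_def fibre_def)
  qed
  then show ?thesis
    by (metis bij_betw_same_card)
qed

text \<open>\<open>A * w\<close> lies in the radical of the span of \<open>A\<close>: it is
  isotropic and orthogonal to all of \<open>A\<close>. Adding a multiple of it leaves
  \<open>b\<close> fixed, but since its product with \<open>c\<close> is nonzero, the norm moves by
  \<open>s + \<sigma> s\<close>, and traces fill \<open>Fq\<close>.\<close>

lemma card_nfibre_equidistributed:
  assumes A: "A \<in> carrier_mat n e" and w: "w \<in> carrier_mat e 1" "adj A * A * w = 0\<^sub>m e 1"
    and b: "b \<in> carrier_mat e 1" "(adj b * w) $$ (0, 0) \<noteq> 0"
    and h: "h \<in> Fq" "h' \<in> Fq"
  shows "card (nfibre n A b h) = card (nfibre n A b h')"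
proof -
  have le: "card (nfibre n A b h) \<le> card (nfibre n A b h')" if h: "h \<in> Fq" "h' \<in> Fq" for h h'
  proof -
    let ?y = "(adj b * w) $$ (0, 0)"
    have "h' - h \<in> Fq"
      using h by (simp add: Fq_iff)
    then have "card {s. s + \<sigma> s = h' - h} \<noteq> 0"
      using card_Fq_and_trace_fibre(2) q_gt_1 by simp
    then obtain s where s: "s + \<sigma> s = h' - h"
      by (auto simp: card_eq_0_iff)
    \<comment> \<open>The factor \<open>s / ?y\<close> makes the product of \<open>d\<close> with
      every vector \<open>c\<close> of the fibre exactly \<open>s\<close>.\<close>
    define d where "d = (s / ?y) \<cdot>\<^sub>m (A * w)"
    have Aw: "A * w \<in> carrier_mat n 1" and d: "d \<in> carrier_mat n 1"
      using A w by (auto simp: d_def)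
    have "qform (adj A * A) w = (adj w * (adj A * A * w)) $$ (0, 0)"
      using A w(1) by (simp add: qform_def mat_mult_assoc)
    then have "nrm (A * w) = 0"
      using nrm_mult[OF A w(1)] w by simp
    then have nd: "nrm d = 0"
      using Aw by (simp add: d_def nrm_smult)
    have Ad: "adj A * d = 0\<^sub>m e 1"
      using A w by (simp add: d_def mult_smult_distrib[of _ e n _ 1] mat_mult_assoc)
    show ?thesis
    proof (rule card_inj_on_le)
      show "inj_on (\<lambda>c. c + d) (nfibre n A b h)"
      proof (rule inj_onI)
        fix c c' assume "c \<in> nfibre n A b h" "c' \<in> nfibre n A b h" "c + d = c' + d"
        moreover have "c = c + d - d" "c' = c' + d - d"
          using calculation(1,2) mat_add_minus_cancel[OF _ d] by (auto simp: nfibre_def fibre_def)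
        ultimately show "c = c'"
          by metis
      qed
      show "(\<lambda>c. c + d) ` nfibre n A b h \<subseteq> nfibre n A b h'"
      proof
        fix c' assume "c' \<in> (\<lambda>c. c + d) ` nfibre n A b h"
        then obtain c where c: "c \<in> carrier_mat n 1" "adj A * c = b" "nrm c = h" "c' = c + d"
          by (auto simp: nfibre_def fibre_def)
        have "adj c * A = adj b"
          using arg_cong[OF c(2), of adj] c(1) A by (simp add: adj_mult)
        then have "adj c * (A * w) = adj b * w"
          using mat_mult_assoc[of "adj c" A w] c(1) A w(1) by simp
        then have "(adj c * d) $$ (0, 0) = s"
          using c(1) Aw b w by (simp add: d_def mult_smult_distrib[of _ 1 n _ 1])
        then have "nrm c' = h'"
          using nrm_add[OF c(1) d] c(3,4) nd s by (simp add: algebra_simps)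
        moreover have "adj A * c' = b"
          using c d A Ad b by (simp add: mat_mult_add)
        ultimately show "c' \<in> nfibre n A b h'"
          using c d by (simp add: nfibre_def fibre_def)
      qed
    qed simp
  qed
  show ?thesis
    using le h by (intro antisym)
qed

text \<open>For hermitian \<open>H\<close> the image is the orthogonal complement of the kernel, so
  a \<open>b\<close> outside the image is detected by a kernel vector. The projection
  \<open>E\<close> kills the image; taking adjoints in \<open>E * H = 0\<close> puts the columns of
  \<open>adj E\<close> into the kernel.\<close>

lemma kernel_witness:
  assumes H: "H \<in> carrier_mat e e" "adj H = H" and b: "b \<in> carrier_mat e 1"
    and notin: "\<And>v. v \<in> carrier_mat e 1 \<Longrightarrow> H * v \<noteq> b"
  obtains w where "w \<in> carrier_mat e 1" "H * w = 0\<^sub>m e 1" "(adj b * w) $$ (0, 0) \<noteq> 0"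
proof -
  obtain r K X where K: "K \<in> carrier_mat e r" "linj e r (H * K)" "X \<in> carrier_mat r e" "H = H * K * X"
    using rank_factorization[OF H(1)] .
  obtain L where L: "L \<in> carrier_mat r e" "L * (H * K) = 1\<^sub>m r"
    using K(2) by (auto simp: linj_def)
  define E where "E = 1\<^sub>m e - H * K * L"
  have E: "E \<in> carrier_mat e e"
    using H K L by (auto simp: E_def)
  have "E * (H * K) = 0\<^sub>m e r"
    using H K L by (simp add: E_def mat_minus_mult mat_mult_assoc)
  then have "E * (H * K * X) = 0\<^sub>m e e"
    using mat_mult_assoc[of E "H * K" X] E H(1) K(1,3) by simp
  then have EH: "E * H = 0\<^sub>m e e"
    using K(4) by simp
  have HE: "H * adj E = 0\<^sub>m e e"
    using arg_cong[OF EH, of adj] E H by (simp add: adj_mult)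
  have "E * b \<noteq> 0\<^sub>m e 1"
  proof
    assume "E * b = 0\<^sub>m e 1"
    then have "b - H * (K * (L * b)) = 0\<^sub>m e 1"
      using H(1) K(1,3) L(1) b by (simp add: E_def mat_minus_mult mat_mult_assoc)
    then have "b = H * (K * (L * b))"
      by (rule mat_diff_eq_0) (use H(1) K(1,3) L(1) b in simp_all)
    then show False
      using notin[of "K * (L * b)"] K(1) L(1) b by auto
  qed
  moreover have "E * b = 0\<^sub>m e 1" if "\<forall>i<e. (E * b) $$ (i, 0) = 0"
    using that E b by (intro eq_matI) auto
  ultimately obtain i where i: "i < e" "(E * b) $$ (i, 0) \<noteq> 0"
    by blast
  define u :: "'k mat" where "u = mat e 1 (\<lambda>(j, _). if j = i then 1 else 0)"
  have u: "u \<in> carrier_mat e 1"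
    by (simp add: u_def)
  have "adj u * M = mat 1 1 (\<lambda>_. M $$ (i, 0))" if "M \<in> carrier_mat e 1" for M
    using that i(1) unfolding u_def
    by (intro eq_matI) (auto simp: scalar_prod_def if_distrib if_distribR cong: if_cong)
  then have uEb: "adj u * (E * b) = mat 1 1 (\<lambda>_. (E * b) $$ (i, 0))"
    using E b by simp
  have "H * (adj E * u) = 0\<^sub>m e 1"
    using mat_mult_assoc[of H "adj E" u] HE E H(1) u by simp
  moreover have "adj (adj b * (adj E * u)) = mat 1 1 (\<lambda>_. (E * b) $$ (i, 0))"
    using E b u by (simp add: adj_mult mat_mult_assoc uEb)
  then have "adj (adj b * (adj E * u)) $$ (0, 0) \<noteq> 0"
    using i by simp
  then have "(adj b * (adj E * u)) $$ (0, 0) \<noteq> 0"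
    using b u E by (subst (asm) index_adj) auto
  ultimately show ?thesis
    using that[of "adj E * u"] E u by simp
qed

abbreviation mq :: rat where "mq \<equiv> - of_nat q"

lemma card_norm_eq:
  fixes n defines "N h \<equiv> rat_of_nat (card {c \<in> carrier_mat n 1. nrm c = h})"
  assumes "h \<in> Fq"
  shows "N h = N 1 + (if h = 0 then N 0 - N 1 else 0)"
proof -
  \<comment> \<open>A matrix with no columns imposes no inner products, so the scaling lemma applies
    to all vectors.\<close>
  have eq: "{c \<in> carrier_mat n 1. nrm c = h} = nfibre n (0\<^sub>m n 0) (0\<^sub>m 0 1) h" for h
    by (auto simp: nfibre_def fibre_def intro!: eq_matI)
  show ?thesis
    unfolding N_def eq using card_nfibre_scale[of "0\<^sub>m n 0" n 0 h] assms(2) by auto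
qed

lemma card_norm_Suc:
  "card {c \<in> carrier_mat (Suc n) 1. nrm c = h} = (\<Sum>x\<in>UNIV. card {c \<in> carrier_mat n 1. nrm c = h - x * \<sigma> x})"
proof -
  let ?S = "SIGMA x:UNIV. {c \<in> carrier_mat n 1. nrm c = h - x * \<sigma> x}"
  let ?last = "\<lambda>c :: 'k mat. c $$ (n, 0)" and ?init = "\<lambda>c :: 'k mat. mat n 1 (\<lambda>(i, _). c $$ (i, 0))"
  have vcat_carr: "vcat c (mat 1 1 (\<lambda>_. x)) \<in> carrier_mat (Suc n) 1" if "c \<in> carrier_mat n 1" for c :: "'k mat" and x
    using that by (auto simp: vcat_def)
  have nrm_vcat: "nrm (vcat c (mat 1 1 (\<lambda>_. x))) = nrm c + x * \<sigma> x" if "c \<in> carrier_mat n 1" for c x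
    using that vcat_carr[OF that, of x] by (simp add: nrm_sum[of _ n] nrm_sum[of _ "Suc n"] vcat_def)
  have inv: "vcat (?init c) (mat 1 1 (\<lambda>_. ?last c)) = c" if "c \<in> carrier_mat (Suc n) 1" for c
    using that by (intro eq_matI) (auto simp: vcat_def less_Suc_eq)
  have "bij_betw (\<lambda>(x, c). vcat c (mat 1 1 (\<lambda>_. x))) ?S {c \<in> carrier_mat (Suc n) 1. nrm c = h}"
  proof (rule bij_betwI[where g = "\<lambda>c. (?last c, ?init c)"])
    show "(\<lambda>(x, c). vcat c (mat 1 1 (\<lambda>_. x))) \<in> ?S \<rightarrow> {c \<in> carrier_mat (Suc n) 1. nrm c = h}"
      using nrm_vcat vcat_carr by (auto simp del: One_nat_def)
    show "(\<lambda>c. (?last c, ?init c)) \<in> {c \<in> carrier_mat (Suc n) 1. nrm c = h} \<rightarrow> ?S"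
    proof
      fix c assume "c \<in> {c \<in> carrier_mat (Suc n) 1. nrm c = h}"
      then have "nrm (?init c) + ?last c * \<sigma> (?last c) = h"
        using nrm_vcat[of "?init c" "?last c"] inv[of c] by simp
      then show "(?last c, ?init c) \<in> ?S"
        by (simp add: eq_diff_eq)
    qed
    show "(?last (case p of (x, c) \<Rightarrow> vcat c (mat 1 1 (\<lambda>_. x))),
      ?init (case p of (x, c) \<Rightarrow> vcat c (mat 1 1 (\<lambda>_. x)))) = p" if "p \<in> ?S" for p
      using that by (auto simp: vcat_def intro!: eq_matI)
    show "(case (?last c, ?init c) of (x, c) \<Rightarrow> vcat c (mat 1 1 (\<lambda>_. x))) = c"
      if "c \<in> {c \<in> carrier_mat (Suc n) 1. nrm c = h}" for c
      using inv[of c] that by simp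
  qed
  then have "card {c \<in> carrier_mat (Suc n) 1. nrm c = h} = card ?S"
    by (rule bij_betw_same_card[symmetric])
  then show ?thesis
    by (simp add: card_SigmaI)
qed

lemma card_norm_diff:
  "rat_of_nat (card {c \<in> carrier_mat n 1. nrm c = 0}) - rat_of_nat (card {c \<in> carrier_mat n 1. nrm c = 1}) = mq ^ n"
proof (induction n)
  case 0
  have "(carrier_mat 0 1 :: 'k mat set) = {0\<^sub>m 0 1}"
    by (auto intro!: eq_matI)
  moreover have "nrm (0\<^sub>m 0 1) = 0"
    by (simp add: nrm_sum[of _ 0])
  ultimately have "{c \<in> carrier_mat 0 1. nrm c = 0} = {0\<^sub>m 0 1}" "{c \<in> carrier_mat 0 1. nrm c = 1} = {}"
    by auto
  then show ?case
    by (simp only:) simp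
next
  case (Suc n)
  let ?N = "\<lambda>n h. rat_of_nat (card {c \<in> carrier_mat n 1. nrm c = h})"
  have "?N (Suc n) 0 - ?N (Suc n) 1 = (\<Sum>x\<in>UNIV. ?N n (0 - x * \<sigma> x) - ?N n (1 - x * \<sigma> x))"
    by (simp only: card_norm_Suc of_nat_sum sum_subtractf)
  \<comment> \<open>By \<open>card_norm_eq\<close> the common part cancels and only those
    \<open>x\<close> contribute whose norm is 0 or 1: one with a plus sign, \<open>q + 1\<close>
    with a minus sign, in total the factor \<open>-q\<close>.\<close>
  also have "\<dots> = (\<Sum>x\<in>UNIV. (if x * \<sigma> x = 0 then mq ^ n else 0) - (if x * \<sigma> x = 1 then mq ^ n else 0))"
  proof (rule sum.cong[OF refl])
    fix x
    have Fq: "0 - x * \<sigma> x \<in> Fq" "1 - x * \<sigma> x \<in> Fq"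
      by (simp_all add: Fq_iff mult.commute)
    have N: "?N n y = ?N n 1 + (if y = 0 then mq ^ n else 0)" if "y \<in> Fq" for y
      using card_norm_eq[OF that, of n] by (simp only: Suc.IH)
    show "?N n (0 - x * \<sigma> x) - ?N n (1 - x * \<sigma> x) =
        (if x * \<sigma> x = 0 then mq ^ n else 0) - (if x * \<sigma> x = 1 then mq ^ n else 0)"
      unfolding N[OF Fq(1)] N[OF Fq(2)] by auto
  qed
  also have "\<dots> = rat_of_nat (card {x. x * \<sigma> x = 0}) * mq ^ n - rat_of_nat (card {x. x * \<sigma> x = 1}) * mq ^ n"
    by (simp add: sum_subtractf sum.If_cases)
  also have "\<dots> = mq ^ n - of_nat (q + 1) * mq ^ n"
    by (subst (1 2) card_norm_fibre) (auto simp: Fq_iff)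
  finally show ?case
    by (simp add: algebra_simps)
qed

text \<open>
  Sort the vectors of norm \<open>h\<close> by \<open>b = adj A * c\<close>. For \<open>b\<close> outside the image of \<open>H\<close> the norm is
  equidistributed, and for \<open>b = H * v\<close> it is translated by \<open>qform H v\<close>. Comparing \<open>h = 0\<close> with
  \<open>h = 1\<close> therefore isolates the gap for \<open>b = 0\<close>, times a factor \<open>\<gamma>\<close> that only sees \<open>H\<close>.
\<close>

lemma nfibre_zero_gap:
  assumes H: "H \<in> carrier_mat e e" "adj H = H"
  obtains \<gamma> :: rat where "\<And>n A. linj n e A \<Longrightarrow> adj A * A = H \<Longrightarrow>
    (rat_of_nat (card (nfibre n A (0\<^sub>m e 1) 0)) - rat_of_nat (card (nfibre n A (0\<^sub>m e 1) 1))) * \<gamma> = mq ^ n"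
proof -
  let ?im = "(\<lambda>v. H * v) ` carrier_mat e 1"
  define pre where "pre b = (SOME v. v \<in> carrier_mat e 1 \<and> H * v = b)" for b
  define \<rho> where "\<rho> b = qform H (pre b)" for b
  have pre: "pre b \<in> carrier_mat e 1 \<and> H * pre b = b" if "b \<in> ?im" for b
    unfolding pre_def by (rule someI_ex) (use that in auto)
  define \<gamma> where "\<gamma> = rat_of_nat (card {b \<in> ?im. \<rho> b = 0}) - rat_of_nat (card {b \<in> ?im. \<rho> b = 1})"
  have "(rat_of_nat (card (nfibre n A (0\<^sub>m e 1) 0)) - rat_of_nat (card (nfibre n A (0\<^sub>m e 1) 1))) * \<gamma> = mq ^ n"
    if lin: "linj n e A" and gram: "adj A * A = H" for n A
  proof -
    note A = linj_carrier[OF lin]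
    define G where "G h = rat_of_nat (card (nfibre n A (0\<^sub>m e 1) h))" for h
    define F where "F b h = rat_of_nat (card (nfibre n A b h))" for b h
    have total: "(\<Sum>b\<in>carrier_mat e 1. F b h) = rat_of_nat (card {c \<in> carrier_mat n 1. nrm c = h})" for h
    proof -
      have "(\<Sum>b\<in>carrier_mat e 1. \<Sum>c\<in>{c \<in> {c \<in> carrier_mat n 1. nrm c = h}. adj A * c = b}. 1) =
          (\<Sum>c\<in>{c \<in> carrier_mat n 1. nrm c = h}. 1 :: rat)"
        by (rule sum.group) (use A in auto)
      moreover have "{c \<in> {c \<in> carrier_mat n 1. nrm c = h}. adj A * c = b} = nfibre n A b h" for b
        by (auto simp: nfibre_def fibre_def)
      ultimately show ?thesis
        by (simp add: F_def)
    qed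
    have F_out: "F b 0 - F b 1 = 0" if b: "b \<in> carrier_mat e 1 - ?im" for b
    proof -
      obtain w where w: "w \<in> carrier_mat e 1" "H * w = 0\<^sub>m e 1" "(adj b * w) $$ (0, 0) \<noteq> 0"
        using kernel_witness[OF H, of b] b by blast
      have "card (nfibre n A b 0) = card (nfibre n A b 1)"
        using b w by (intro card_nfibre_equidistributed[OF A w(1)]) (auto simp: gram Fq_iff)
      then show ?thesis
        by (simp add: F_def)
    qed
    have G_eq: "G h = G 1 + (if h = 0 then G 0 - G 1 else 0)" if "h \<in> Fq" for h
      using card_nfibre_scale[OF A that] by (simp add: G_def)
    have F_in: "F b 0 - F b 1 = (if \<rho> b = 0 then G 0 - G 1 else 0) - (if \<rho> b = 1 then G 0 - G 1 else 0)"
      if b: "b \<in> ?im" for b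
    proof -
      have F: "F b h = G (h - \<rho> b)" for h
        using card_nfibre_translate[OF A, of "pre b" h] pre[OF b] gram by (simp add: F_def G_def \<rho>_def)
      have "\<rho> b \<in> Fq"
        unfolding \<rho>_def using qform_Fq[OF H] pre[OF b] by blast
      then have "0 - \<rho> b \<in> Fq" "1 - \<rho> b \<in> Fq"
        by (simp_all add: Fq_iff)
      then show ?thesis
        unfolding F using G_eq[of "0 - \<rho> b"] G_eq[of "1 - \<rho> b"] by auto
    qed
    have "mq ^ n = (\<Sum>b\<in>carrier_mat e 1. F b 0 - F b 1)"
      by (simp add: sum_subtractf total card_norm_diff del: One_nat_def)
    also have "\<dots> = (\<Sum>b\<in>?im. F b 0 - F b 1)"
      using H F_out by (intro sum.mono_neutral_right) auto
    also have "\<dots> = (\<Sum>b\<in>?im. (if \<rho> b = 0 then G 0 - G 1 else 0) - (if \<rho> b = 1 then G 0 - G 1 else 0))"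
      by (intro sum.cong refl F_in)
    also have "\<dots> = (G 0 - G 1) * \<gamma>"
    proof -
      have S: "(\<Sum>b\<in>?im. if \<rho> b = h then G 0 - G 1 else 0) = of_nat (card {b \<in> ?im. \<rho> b = h}) * (G 0 - G 1)" for h
        by (subst sum.inter_filter[symmetric]) auto
      show ?thesis
        unfolding sum_subtractf S \<gamma>_def by (simp add: algebra_simps)
    qed
    finally show ?thesis
      by (simp add: G_def)
  qed
  then show ?thesis
    using that by blast
qed

text \<open>For \<open>b\<close> outside the image of \<open>H\<close>, the whole fibre is shared
  equally among the \<open>q\<close> possible norms. For \<open>b\<close> inside, translation
  reduces to \<open>b = 0\<close>, where two linear equations, the total over all norms and the gap
  between norm 0 and norm 1, determine both counts.\<close>

lemma nfibre_poly:
  assumes H: "H \<in> carrier_mat e e" "adj H = H" and b: "b \<in> carrier_mat e 1"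
  obtains f :: "rat poly" where "\<And>n A. linj n e A \<Longrightarrow> adj A * A = H \<Longrightarrow>
    rat_of_nat (card (nfibre n A b h)) = poly f (mq ^ n)"
proof -
  define Q where "Q = rat_of_nat (q ^ (2 * e))"
  have Q0: "Q \<noteq> 0" "rat_of_nat q \<noteq> 0"
    using q_gt_1 by (auto simp: Q_def)
  have fib: "rat_of_nat (card (fibre n A b')) = (mq ^ n)\<^sup>2 / Q" if "linj n e A" "b' \<in> carrier_mat e 1" for n A b'
  proof -
    have "rat_of_nat (card (fibre n A b')) * Q = rat_of_nat (q ^ (2 * n))"
      unfolding Q_def using card_fibre[OF that] by (metis of_nat_mult)
    also have "\<dots> = (mq\<^sup>2) ^ n"
      by (simp add: power_mult)
    also have "\<dots> = (mq ^ n)\<^sup>2"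
      by (simp only: power_mult[symmetric] mult.commute)
    finally show ?thesis
      using Q0 by (simp add: field_simps)
  qed
  consider "h \<notin> Fq" | "h \<in> Fq" "\<And>v. v \<in> carrier_mat e 1 \<Longrightarrow> H * v \<noteq> b"
    | v where "h \<in> Fq" "v \<in> carrier_mat e 1" "H * v = b"
    by blast
  then show ?thesis
  proof cases
    case 1
    then have "nfibre n A b h = {}" for n A
      using nrm_Fq by (auto simp: nfibre_def fibre_def)
    then show ?thesis
      using that[of 0] by simp
  next
    case 2
    obtain w where w: "w \<in> carrier_mat e 1" "H * w = 0\<^sub>m e 1" "(adj b * w) $$ (0, 0) \<noteq> 0"
      using kernel_witness[OF H b 2(2)] by blast
    have "rat_of_nat (card (nfibre n A b h)) = poly (monom (1 / (Q * of_nat q)) 2) (mq ^ n)"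
      if "linj n e A" "adj A * A = H" for n A
    proof -
      have "card (fibre n A b) = (\<Sum>h'\<in>Fq. card (nfibre n A b h))"
        unfolding card_fibre_nfibre
        using card_nfibre_equidistributed[OF linj_carrier[OF that(1)] w(1) _ b w(3) _ 2(1)] that(2) w(2)
        by (intro sum.cong) auto
      then have "(mq ^ n)\<^sup>2 / Q = of_nat q * rat_of_nat (card (nfibre n A b h))"
        using fib[OF that(1) b] card_Fq_and_trace_fibre(1) by simp
      then show ?thesis
        using Q0 by (simp add: poly_monom field_simps)
    qed
    then show ?thesis
      using that by blast
  next
    case (3 v)
    obtain \<gamma> where \<gamma>: "\<And>n A. linj n e A \<Longrightarrow> adj A * A = H \<Longrightarrow>
        (rat_of_nat (card (nfibre n A (0\<^sub>m e 1) 0)) - rat_of_nat (card (nfibre n A (0\<^sub>m e 1) 1))) * \<gamma> = mq ^ n"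
      using nfibre_zero_gap[OF H] by blast
    \<comment> \<open>Solution of \<open>q * G 1 + (G 0 - G 1) = x ^ 2 / Q\<close> and
      \<open>G 0 - G 1 = x / \<gamma>\<close> at \<open>x = mq ^ n\<close>. That
      \<open>\<gamma>\<close> is nonzero follows once a single \<open>A\<close> exists, because its
      product with the gap is \<open>mq ^ n\<close>.\<close>
    let ?f = "smult (1 / of_nat q) (monom (1 / Q) 2 - monom (1 / \<gamma>) 1) +
      (if h - qform H v = 0 then monom (1 / \<gamma>) 1 else 0)"
    have "rat_of_nat (card (nfibre n A b h)) = poly ?f (mq ^ n)"
      if "linj n e A" "adj A * A = H" for n A
    proof -
      note A = linj_carrier[OF that(1)]
      define G where "G h = rat_of_nat (card (nfibre n A (0\<^sub>m e 1) h))" for h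
      have G_eq: "G h = G 1 + (if h = 0 then G 0 - G 1 else 0)" if "h \<in> Fq" for h
        using card_nfibre_scale[OF A that] by (simp add: G_def)
      have "(G 0 - G 1) * \<gamma> = mq ^ n"
        unfolding G_def by (rule \<gamma>[OF that])
      moreover have "mq ^ n \<noteq> 0"
        using Q0 by simp
      ultimately have "\<gamma> \<noteq> 0"
        by auto
      with \<open>(G 0 - G 1) * \<gamma> = mq ^ n\<close> have gap: "G 0 - G 1 = mq ^ n / \<gamma>"
        by (simp add: eq_divide_eq)
      have "(mq ^ n)\<^sup>2 / Q = (\<Sum>h\<in>Fq. G h)"
        using fib[OF that(1), of "0\<^sub>m e 1"] card_fibre_nfibre[of n A "0\<^sub>m e 1"] by (simp add: G_def)
      also have "\<dots> = (\<Sum>h\<in>Fq. G 1 + (if h = 0 then G 0 - G 1 else 0))"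
        by (intro sum.cong refl G_eq)
      also have "\<dots> = of_nat q * G 1 + (G 0 - G 1)"
        by (simp add: sum.distrib card_Fq_and_trace_fibre(1) Fq_iff)
      finally have "(mq ^ n)\<^sup>2 / Q - mq ^ n / \<gamma> = of_nat q * G 1"
        unfolding gap by simp
      then have G1: "G 1 = ((mq ^ n)\<^sup>2 / Q - mq ^ n / \<gamma>) / of_nat q"
        using Q0 by simp
      have "h - qform H v \<in> Fq"
        using 3(1) qform_Fq[OF H 3(2)] by (simp add: Fq_iff)
      then have "rat_of_nat (card (nfibre n A b h)) = G 1 + (if h - qform H v = 0 then G 0 - G 1 else 0)"
        using card_nfibre_translate[OF A 3(2), of h] that(2) 3(3) G_eq by (metis G_def)
      then show ?thesis
        unfolding gap unfolding G1 by (simp add: poly_monom)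
    qed
    then show ?thesis
      using that by blast
  qed
qed

text \<open>The vectors to be removed are the \<open>A * v\<close> with \<open>H * v = b\<close> and
  \<open>qform H v = h\<close>. Their number depends on \<open>H\<close> alone, so only a constant
  is subtracted.\<close>

lemma new_column_poly:
  assumes H: "H \<in> carrier_mat e e" "adj H = H" and b: "b \<in> carrier_mat e 1"
  obtains f :: "rat poly" where "\<And>n A. linj n e A \<Longrightarrow> adj A * A = H \<Longrightarrow>
    rat_of_nat (card {c \<in> nfibre n A b h. \<forall>v\<in>carrier_mat e 1. A * v \<noteq> c}) = poly f (mq ^ n)"
proof -
  obtain f :: "rat poly" where f: "\<And>n A. linj n e A \<Longrightarrow> adj A * A = H \<Longrightarrow>
    rat_of_nat (card (nfibre n A b h)) = poly f (mq ^ n)"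
    using nfibre_poly[OF assms] by blast
  let ?V = "{v \<in> carrier_mat e 1. H * v = b \<and> qform H v = h}"
  have "rat_of_nat (card {c \<in> nfibre n A b h. \<forall>v\<in>carrier_mat e 1. A * v \<noteq> c}) = poly (f - [:of_nat (card ?V):]) (mq ^ n)"
    if "linj n e A" "adj A * A = H" for n A
  proof -
    note A = linj_carrier[OF that(1)]
    have mem: "A * v \<in> nfibre n A b h \<longleftrightarrow> v \<in> ?V" if "v \<in> carrier_mat e 1" for v
    proof -
      have "adj A * (A * v) = H * v"
        using mat_mult_assoc[of "adj A" A v] that A \<open>adj A * A = H\<close> by simp
      moreover have "A * v \<in> carrier_mat n 1"
        using A that by simp
      ultimately show ?thesis
        using that nrm_mult[OF A that] \<open>adj A * A = H\<close> by (simp add: nfibre_def fibre_def)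
    qed
    then have sub: "(\<lambda>v. A * v) ` ?V \<subseteq> nfibre n A b h"
      by blast
    have "{c \<in> nfibre n A b h. \<forall>v\<in>carrier_mat e 1. A * v \<noteq> c} = nfibre n A b h - (\<lambda>v. A * v) ` ?V"
      using mem by blast
    moreover have "card ((\<lambda>v. A * v) ` ?V) = card ?V"
      using linj_cancel[OF that(1)] by (intro card_image inj_onI) auto
    moreover have "card ((\<lambda>v. A * v) ` ?V) \<le> card (nfibre n A b h)"
      using sub by (intro card_mono) auto
    ultimately show ?thesis
      using f[OF that] sub by (simp add: card_Diff_subset of_nat_diff)
  qed
  then show ?thesis
    using that by blast
qed

section \<open>Extensions with prescribed Gram matrix\<close>

lemma adj_hcat: "dim_row A = dim_row B \<Longrightarrow> adj (hcat A B) = vcat (adj A) (adj B)"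
  by (rule eq_matI) (auto simp: hcat_def vcat_def)

lemma gram_hcat:
  assumes "A \<in> carrier_mat n a" "B \<in> carrier_mat n b" "H \<in> carrier_mat n n"
  shows "adj (hcat A B) * H * hcat A B =
    vcat (hcat (adj A * H * A) (adj A * H * B)) (hcat (adj B * H * A) (adj B * H * B))"
proof -
  have "adj (hcat A B) * H * hcat A B = vcat (adj A) (adj B) * hcat (H * A) (H * B)"
    using assms by (simp add: adj_hcat mat_mult_assoc mult_hcat)
  also have "\<dots> = vcat (hcat (adj A * (H * A)) (adj A * (H * B))) (hcat (adj B * (H * A)) (adj B * (H * B)))"
    using assms by (subst vcat_mult) (simp_all add: mult_hcat)
  finally show ?thesis
    using assms by (simp add: mat_mult_assoc)
qed

text \<open>Isometric embeddings of the space of dimension \<open>d\<close> with form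
  \<open>H\<close> into the standard hermitian space, with prescribed restriction \<open>A0\<close>
  along \<open>P\<close>.\<close>

definition extensions :: "nat \<Rightarrow> nat \<Rightarrow> 'k mat \<Rightarrow> 'k mat \<Rightarrow> 'k mat \<Rightarrow> 'k mat set" where
  "extensions n d H P A0 = {A. linj n d A \<and> adj A * A = H \<and> A * P = A0}"

lemma finite_linj [simp]: "finite {A :: 'k mat. linj n d A}"
  by (rule finite_subset[OF _ finite_carrier_mat[of n d]]) (auto dest: linj_carrier)

lemma finite_extensions [simp]: "finite (extensions n d H P A0)"
  by (rule finite_subset[OF _ finite_linj[of n d]]) (auto simp: extensions_def)

text \<open>Induction on the number \<open>d - e\<close> of missing columns. A vector
  \<open>v\<close> outside the image of \<open>P\<close> is adjoined; its image \<open>A * v\<close>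
  is one of the new columns counted by \<open>new_column_poly\<close>, and each of these completes
  in the same number of ways because \<open>f'\<close> sees only the Gram matrix. The two
  polynomials multiply.\<close>

lemma extension_poly:
  assumes "linj d e P" "H \<in> carrier_mat d d"
  obtains f :: "rat poly" where "\<And>n A0. linj n e A0 \<Longrightarrow> adj A0 * A0 = adj P * H * P \<Longrightarrow>
    rat_of_nat (card (extensions n d H P A0)) = poly f (mq ^ n)"
proof (cases "adj H = H")
  case False
  have "adj (adj A * A) = adj A * A" for A :: "'k mat"
    by (simp add: adj_mult)
  with False have "extensions n d H P A0 = {}" for n A0
    by (auto simp: extensions_def)
  then show ?thesis
    using that[of 0] by simp
next
  case True
  have "\<exists>f :: rat poly. \<forall>n A0. linj n e A0 \<longrightarrow> adj A0 * A0 = adj P * H * P \<longrightarrow>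
    rat_of_nat (card (extensions n d H P A0)) = poly f (mq ^ n)"
    using assms(1)
  proof (induction "d - e" arbitrary: e P)
    case 0
    then have "d = e"
      using linj_dim_le by fastforce
    then obtain R where R: "R \<in> carrier_mat d d" "R * P = 1\<^sub>m d" "P * R = 1\<^sub>m d"
      using linj_square 0(2) by blast
    have P: "P \<in> carrier_mat d d"
      using 0(2) \<open>d = e\<close> linj_carrier by blast
    have lR: "linj d d R"
      using R P by (auto simp: linj_def)
    \<comment> \<open>With \<open>P\<close> invertible, \<open>A * P = A0\<close> leaves only
      \<open>A0 * R\<close>, and the Gram condition on \<open>A0\<close> makes it an
      extension.\<close>
    have "extensions n d H P A0 = {A0 * R}"
      if A0: "linj n e A0" and gram: "adj A0 * A0 = adj P * H * P" for n A0
    proof -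
      have A0c: "A0 \<in> carrier_mat n d"
        using A0 \<open>d = e\<close> linj_carrier by blast
      have "A = A0 * R" if "A \<in> extensions n d H P A0" for A
      proof -
        have "A \<in> carrier_mat n d" "A0 = A * P"
          using that linj_carrier by (auto simp: extensions_def)
        then show ?thesis
          using P R by (simp add: mat_mult_assoc)
      qed
      moreover have "A0 * R \<in> extensions n d H P A0"
      proof -
        have PR: "adj R * adj P = 1\<^sub>m d"
          using arg_cong[OF R(3), of adj] P R(1) by (simp add: adj_mult)
        have "adj (A0 * R) * (A0 * R) = adj R * ((adj A0 * A0) * R)"
          using A0c R(1) by (simp add: adj_mult mat_mult_assoc)
        also have "\<dots> = adj R * (adj P * (H * (P * R)))"
          unfolding gram using A0c R(1) P assms(2) by (simp add: mat_mult_assoc)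
        also have "\<dots> = H"
          using R P PR assms(2) by (simp add: mat_left_cancel)
        finally show ?thesis
          using linj_mult[OF A0[folded \<open>d = e\<close>] lR] A0c R P by (simp add: extensions_def mat_mult_assoc)
      qed
      ultimately show ?thesis
        by blast
    qed
    then show ?case
      by (intro exI[of _ 1]) simp
  next
    case (Suc m)
    note P = linj_carrier[OF Suc.prems]
    have "e < d"
      using Suc.hyps(2) by simp
    then obtain v where v: "v \<in> carrier_mat d 1" "\<And>u. u \<in> carrier_mat e 1 \<Longrightarrow> P * u \<noteq> v"
      using linj_not_surj[OF Suc.prems] by blast
    have P': "linj d (e + 1) (hcat P v)"
      by (rule linj_hcat[OF Suc.prems v])
    have "m = d - (e + 1)"
      using Suc.hyps(2) by simp
    from Suc.hyps(1)[OF this P'] obtain f' :: "rat poly" where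
      f': "\<And>n A0. linj n (e + 1) A0 \<Longrightarrow> adj A0 * A0 = adj (hcat P v) * H * hcat P v \<Longrightarrow>
        rat_of_nat (card (extensions n d H (hcat P v) A0)) = poly f' (mq ^ n)"
      by blast
    have "adj P * H * P \<in> carrier_mat e e" "adj (adj P * H * P) = adj P * H * P" "adj P * H * v \<in> carrier_mat e 1"
      using P assms(2) True v(1) by (simp_all add: adj_mult mat_mult_assoc)
    from new_column_poly[OF this, of "qform H v"] obtain g :: "rat poly" where
      g: "\<And>n A. linj n e A \<Longrightarrow> adj A * A = adj P * H * P \<Longrightarrow>
        rat_of_nat (card {c \<in> nfibre n A (adj P * H * v) (qform H v). \<forall>u\<in>carrier_mat e 1. A * u \<noteq> c}) = poly g (mq ^ n)"
      by blast
    have "rat_of_nat (card (extensions n d H P A0)) = poly (g * f') (mq ^ n)"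
      if A0: "linj n e A0" and gram: "adj A0 * A0 = adj P * H * P" for n A0
    proof -
      note A0c = linj_carrier[OF A0]
      define C where "C = {c \<in> nfibre n A0 (adj P * H * v) (qform H v). \<forall>u\<in>carrier_mat e 1. A0 * u \<noteq> c}"
      have into: "A * v \<in> C" if "A \<in> extensions n d H P A0" for A
      proof -
        have A: "linj n d A" "adj A * A = H" "A0 = A * P" and Ac: "A \<in> carrier_mat n d"
          using that linj_carrier by (auto simp: extensions_def)
        have "adj A0 * (A * v) = adj P * (adj A * A) * v"
          using A(3) Ac P v(1) by (simp add: adj_mult mat_mult_assoc)
        moreover have "A0 * u \<noteq> A * v" if "u \<in> carrier_mat e 1" for u
        proof
          assume "A0 * u = A * v"
          then have "A * (P * u) = A * v"
            using A(3) Ac P that by (simp add: mat_mult_assoc)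
          then have "P * u = v"
            using linj_cancel[OF A(1), of "P * u" 1 v] P that v(1) by simp
          then show False
            using v(2)[OF that] by blast
        qed
        ultimately show ?thesis
          using nrm_mult[OF Ac v(1)] A(2) Ac v(1) by (simp add: C_def nfibre_def fibre_def)
      qed
      have step: "{A \<in> extensions n d H P A0. A * v = c} = extensions n d H (hcat P v) (hcat A0 c)"
        if "c \<in> C" for c
      proof -
        have c: "c \<in> carrier_mat n 1"
          using that by (auto simp: C_def nfibre_def fibre_def)
        have "A * hcat P v = hcat A0 c \<longleftrightarrow> A * P = A0 \<and> A * v = c" if "linj n d A" for A
          using linj_carrier[OF that] P v(1) c A0c
          by (subst mult_hcat) (auto intro!: hcat_eq_iff[of _ n, THEN iffD1] simp: hcat_eq_iff[of _ n])
        then show ?thesis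
          by (auto simp: extensions_def)
      qed
      have card_step: "rat_of_nat (card (extensions n d H (hcat P v) (hcat A0 c))) = poly f' (mq ^ n)"
        if "c \<in> C" for c
      proof (rule f')
        have c: "c \<in> carrier_mat n 1" "adj A0 * c = adj P * H * v" "nrm c = qform H v"
          using that by (auto simp: C_def nfibre_def fibre_def)
        show "linj n (e + 1) (hcat A0 c)"
          using that by (intro linj_hcat[OF A0 c(1)]) (auto simp: C_def)
        have "adj c * A0 = adj v * H * P"
          using arg_cong[OF c(2), of adj] c(1) A0c P v(1) assms(2) True by (simp add: adj_mult mat_mult_assoc)
        moreover have "adj c * c = adj v * H * v"
          using c(1,3) v(1) by (intro eq_matI) (auto simp: nrm_def qform_def)
        ultimately show "adj (hcat A0 c) * hcat A0 c = adj (hcat P v) * H * hcat P v"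
          using gram_hcat[OF A0c c(1), of "1\<^sub>m n"] gram_hcat[OF P v(1) assms(2)] gram c(1,2) A0c by simp
      qed
      have "card (extensions n d H P A0) = (\<Sum>c\<in>C. card {A \<in> extensions n d H P A0. A * v = c})"
      proof -
        have "(\<Sum>c\<in>C. \<Sum>A\<in>{A \<in> extensions n d H P A0. A * v = c}. 1) = (\<Sum>A\<in>extensions n d H P A0. 1 :: nat)"
          by (rule sum.group) (use into in \<open>auto simp: C_def\<close>)
        then show ?thesis
          by simp
      qed
      then have "rat_of_nat (card (extensions n d H P A0)) = (\<Sum>c\<in>C. poly f' (mq ^ n))"
        by (simp add: step card_step)
      then show ?thesis
        using g[OF A0 gram] by (simp add: C_def)
    qed
    then show ?case
      by blast
  qed
  then show ?thesis
    using that by blast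
qed

end

section \<open>Wall's parametrization and Witt's theorem\<close>

lemma vcat_linj:
  fixes A :: "'a::field mat"
  assumes A: "A \<in> carrier_mat n d"
  shows "linj (n + k) d (vcat A (0\<^sub>m k d)) \<longleftrightarrow> linj n d A"
proof
  let ?I = "vcat (1\<^sub>m n) (0\<^sub>m k n) :: 'a mat"
  have I: "?I \<in> carrier_mat (n + k) n"
    by (rule vcat_carrier) auto
  have eq: "vcat A (0\<^sub>m k d) = ?I * A"
    using A by (simp add: vcat_mult)
  show "linj n d A" if "linj (n + k) d (vcat A (0\<^sub>m k d))"
    using linj_right_factor[OF that[unfolded eq] I A] .
  have "hcat (1\<^sub>m n) (0\<^sub>m n k) * ?I = 1\<^sub>m n"
    by (subst hcat_vcat_mult) auto
  then have "linj (n + k) n ?I"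
    unfolding linj_def using I hcat_carrier[of "1\<^sub>m n" n n "0\<^sub>m n k" k] by auto
  then show "linj (n + k) d (vcat A (0\<^sub>m k d))" if "linj n d A"
    unfolding eq using linj_mult that by blast
qed

text \<open>The embedding \<open>diag(g, 1)\<close> pads \<open>g - 1\<close> with zeros;
  \<open>corner k\<close> is this padding.\<close>

definition corner :: "nat \<Rightarrow> 'a::zero mat \<Rightarrow> 'a mat" where
  "corner k M = vcat (hcat M (0\<^sub>m (dim_row M) k)) (0\<^sub>m k (dim_col M + k))"

lemma corner_carrier: "M \<in> carrier_mat n m \<Longrightarrow> corner k M \<in> carrier_mat (n + k) (m + k)"
  by (auto simp: corner_def)

lemma corner_inject:
  assumes "M \<in> carrier_mat n m" "M' \<in> carrier_mat n m"
  shows "corner k M = corner k M' \<longleftrightarrow> M = M'"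
proof -
  have "corner k M = corner k M' \<longleftrightarrow> hcat M (0\<^sub>m n k) = hcat M' (0\<^sub>m n k)"
    using assms unfolding corner_def by (subst vcat_eq_iff[of _ "m + k"]) auto
  also have "\<dots> \<longleftrightarrow> M = M'"
    using assms by (subst hcat_eq_iff[of _ n]) auto
  finally show ?thesis .
qed

lemma embed_eq_corner:
  fixes M :: "'a::field mat"
  assumes "M \<in> carrier_mat n n"
  shows "embed_mat (n + k) (1\<^sub>m n + M) = 1\<^sub>m (n + k) + corner k M"
  using assms by (intro eq_matI) (auto simp: embed_mat_def corner_def vcat_def hcat_def)

lemma mat_add_left_cancel:
  fixes A :: "'a::group_add mat"
  assumes eq: "A + B = A + C" and "A \<in> carrier_mat n m" "B \<in> carrier_mat n m" "C \<in> carrier_mat n m"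
  shows "B = C"
proof (rule eq_matI)
  fix i j
  assume "i < dim_row C" "j < dim_col C"
  then show "B $$ (i, j) = C $$ (i, j)"
    using arg_cong[OF eq, of "\<lambda>M. M $$ (i, j)"] assms(2-) by simp
qed (use assms in auto)

context hermitian_field
begin

text \<open>\<open>S\<close> is allowed to be singular, so that one \<open>A\<close> can present two
  group elements at once, even when neither image alone fills its span.\<close>

definition wall :: "'k mat \<Rightarrow> 'k mat \<Rightarrow> 'k mat" where
  "wall A S = 1\<^sub>m (dim_row A) + A * S * adj A"

lemma wall_carrier: "A \<in> carrier_mat n d \<Longrightarrow> wall A S \<in> carrier_mat n n"
  by (auto simp: wall_def)

lemma linj_conj_cancel:
  assumes A: "linj n d A" and B: "linj m e B" and XY: "X \<in> carrier_mat d e" "Y \<in> carrier_mat d e"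
    and eq: "A * X * adj B = A * Y * adj B"
  shows "X = Y"
proof -
  note c = linj_carrier[OF A] linj_carrier[OF B]
  have "A * (X * adj B) = A * (Y * adj B)"
    using eq c XY by (simp add: mat_mult_assoc)
  then have "X * adj B = Y * adj B"
    by (rule linj_cancel[OF A, rotated 2]) (use c XY in auto)
  from arg_cong[OF this, of adj] have "B * adj X = B * adj Y"
    using c XY by (simp add: adj_mult)
  then have "adj X = adj Y"
    by (rule linj_cancel[OF B, rotated 2]) (use XY in auto)
  then show ?thesis
    by (simp add: adj_eq_iff)
qed

lemma wall_inject:
  assumes "linj n d A" "S \<in> carrier_mat d d" "T \<in> carrier_mat d d" "wall A S = wall A T"
  shows "S = T"
proof -
  note A = linj_carrier[OF assms(1)]
  have "1\<^sub>m n + A * S * adj A = 1\<^sub>m n + A * T * adj A"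
    using assms(4) A by (simp add: wall_def)
  then have "A * S * adj A = A * T * adj A"
    by (rule mat_add_left_cancel) (use A assms(2,3) in auto)
  then show ?thesis
    using linj_conj_cancel assms by blast
qed

text \<open>The product keeps the same \<open>A\<close>, and its coefficient matrix sees
  \<open>A\<close> only through the Gram matrix. Unitarity and the equation \<open>x * y = g\<close>
  thereby become conditions on data independent of \<open>n\<close>.\<close>

lemma wall_mult:
  assumes "A \<in> carrier_mat n d" "S \<in> carrier_mat d d" "T \<in> carrier_mat d d"
  shows "wall A S * wall A T = wall A (S + T + S * (adj A * A) * T)"
proof -
  have "wall A S * wall A T = 1\<^sub>m n + A * S * adj A + (A * T * adj A + A * S * adj A * (A * T * adj A))"
    using assms unfolding wall_def
    by (subst mat_add_mult) (auto simp: mat_mult_add intro!: eq_matI simp del: index_mult_mat(1))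
  also have "A * S * adj A * (A * T * adj A) = A * (S * (adj A * A) * T) * adj A"
    using assms by (simp add: mat_mult_assoc)
  finally show ?thesis
    using assms unfolding wall_def
    by (simp add: mat_mult_add mat_add_mult) (auto intro!: eq_matI simp del: index_mult_mat(1))
qed

lemma wall_zero: "A \<in> carrier_mat n d \<Longrightarrow> wall A (0\<^sub>m d d) = 1\<^sub>m n"
  by (auto simp: wall_def)

lemma adj_wall:
  assumes "A \<in> carrier_mat n d" "S \<in> carrier_mat d d"
  shows "adj (wall A S) = wall A (adj S)"
  using assms by (simp add: wall_def adj_add adj_mult mat_mult_assoc)

lemma wall_unitary_iff:
  assumes "linj n d A" "S \<in> carrier_mat d d"
  shows "wall A S \<in> unitary_group q n \<longleftrightarrow> adj S + S + adj S * (adj A * A) * S = 0\<^sub>m d d"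
proof -
  note A = linj_carrier[OF assms(1)]
  have "adj (wall A S) * wall A S = wall A (adj S + S + adj S * (adj A * A) * S)"
    using A assms(2) by (simp add: adj_wall wall_mult)
  moreover have "adj S + S + adj S * (adj A * A) * S \<in> carrier_mat d d"
    using A assms(2) by auto
  ultimately show ?thesis
    using wall_zero[OF A] wall_inject[OF assms(1) _ zero_carrier_mat] wall_carrier[OF A]
    by (metis unitary_group_iff)
qed

lemma wall_conj:
  assumes h: "h \<in> unitary_group q n" and A: "A \<in> carrier_mat n d" and S: "S \<in> carrier_mat d d"
  shows "h * wall A S * adj h = wall (h * A) S"
proof -
  have hc: "h \<in> carrier_mat n n"
    using h by (simp add: unitary_group_iff)
  have "h * wall A S * adj h = h * adj h + h * (A * S * adj A) * adj h"
    using hc A S by (simp add: wall_def mat_mult_add mat_add_mult)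
  also have "h * (A * S * adj A) * adj h = h * A * S * adj (h * A)"
    using hc A S by (simp add: adj_mult mat_mult_assoc)
  finally show ?thesis
    using unitary_right[OF h] hc by (simp add: wall_def)
qed

lemma wall_mult_right:
  assumes "A \<in> carrier_mat n d" "P \<in> carrier_mat d e" "R \<in> carrier_mat e e"
  shows "wall (A * P) R = wall A (P * R * adj P)"
  using assms by (simp add: wall_def adj_mult mat_mult_assoc)

lemma gram_vcat_zero:
  assumes "A \<in> carrier_mat n d"
  shows "adj (vcat A (0\<^sub>m k d)) * vcat A (0\<^sub>m k d) = adj A * A"
proof -
  have "adj (vcat A (0\<^sub>m k d)) = hcat (adj A) (adj (0\<^sub>m k d))"
    using assms by (intro eq_matI) (auto simp: vcat_def hcat_def)
  then show ?thesis
    using assms by (simp add: hcat_vcat_mult)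
qed

lemma vcat_zero_conj:
  assumes "A \<in> carrier_mat n d" "S \<in> carrier_mat d d"
  shows "vcat A (0\<^sub>m k d) * S * adj (vcat A (0\<^sub>m k d)) = corner k (A * S * adj A)"
proof -
  have adj: "adj (vcat A (0\<^sub>m k d)) = hcat (adj A) (0\<^sub>m d k)"
    using assms by (intro eq_matI) (auto simp: vcat_def hcat_def)
  have "vcat A (0\<^sub>m k d) * S = vcat (A * S) (0\<^sub>m k d)"
    using assms by (subst vcat_mult) auto
  moreover have "vcat (A * S) (0\<^sub>m k d) * hcat (adj A) (0\<^sub>m d k) =
      vcat (A * S * hcat (adj A) (0\<^sub>m d k)) (0\<^sub>m k d * hcat (adj A) (0\<^sub>m d k))"
    using assms by (intro vcat_mult) auto
  moreover have "A * S * hcat (adj A) (0\<^sub>m d k) = hcat (A * S * adj A) (A * S * 0\<^sub>m d k)"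
    using assms by (intro mult_hcat) auto
  ultimately show ?thesis
    using assms unfolding adj corner_def by simp
qed

lemma embed_wall:
  assumes "A \<in> carrier_mat n d" "S \<in> carrier_mat d d"
  shows "embed_mat (n + k) (wall A S) = wall (vcat A (0\<^sub>m k d)) S"
  using assms vcat_zero_conj[OF assms, of k] embed_eq_corner[of "A * S * adj A" n k]
  by (simp add: wall_def)

text \<open>
  The isometries carrying \<open>A\<close> to \<open>A'\<close> are the extensions of \<open>A'\<close> along \<open>A\<close> with Gram matrix \<open>1\<close>;
  there are as many as for \<open>A' = A\<close>, where the identity is one.
\<close>

lemma witt_extension:
  assumes A: "linj n d A" and A': "linj n d A'" and gram: "adj A * A = adj A' * A'"
  obtains h where "h \<in> unitary_group q n" "h * A = A'"
proof -
  note c = linj_carrier[OF A]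
  obtain f :: "rat poly" where f: "\<And>m A0. linj m d A0 \<Longrightarrow> adj A0 * A0 = adj A * 1\<^sub>m n * A \<Longrightarrow>
    rat_of_nat (card (extensions m n (1\<^sub>m n) A A0)) = poly f (mq ^ m)"
    using extension_poly[OF A one_carrier_mat] by blast
  have "rat_of_nat (card (extensions n n (1\<^sub>m n) A A)) = rat_of_nat (card (extensions n n (1\<^sub>m n) A A'))"
    using f[OF A] f[OF A'] gram c by simp
  moreover have "linj n n (1\<^sub>m n :: 'k mat)"
    unfolding linj_def by (auto intro!: bexI[of _ "1\<^sub>m n"])
  then have "1\<^sub>m n \<in> extensions n n (1\<^sub>m n) A A"
    using c by (simp add: extensions_def)
  then have "card (extensions n n (1\<^sub>m n) A A) \<noteq> 0"
    by (auto simp: card_eq_0_iff)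
  ultimately have "extensions n n (1\<^sub>m n) A A' \<noteq> {}"
    by auto
  then show ?thesis
    using that linj_carrier by (auto simp: extensions_def unitary_group_iff)
qed

text \<open>\<open>D = x - 1\<close> satisfies \<open>adj D = - (D * adj x)\<close>, so the columns
  of \<open>adj D\<close> lie in the image of \<open>D\<close>. As \<open>A * L\<close> fixes that
  image, it fixes both \<open>D\<close> and \<open>adj D\<close>; the adjoint of the second
  statement supplies the factor \<open>adj L * adj A\<close> on the right of
  \<open>D\<close>.\<close>

lemma wall_of_unitary:
  assumes x: "x \<in> unitary_group q n" and A: "A \<in> carrier_mat n r" and L: "L \<in> carrier_mat r n"
    and ALx: "A * (L * (x - 1\<^sub>m n)) = x - 1\<^sub>m n"
  shows "x = wall A (L * (x - 1\<^sub>m n) * adj L)"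
proof -
  have xc: "x \<in> carrier_mat n n"
    using x by (simp add: unitary_group_iff)
  define D where "D = x - 1\<^sub>m n"
  have D: "D \<in> carrier_mat n n"
    unfolding D_def by (rule minus_carrier_mat) simp
  have ALD: "A * (L * D) = D"
    using ALx by (simp add: D_def)
  have "D * adj x = 1\<^sub>m n - adj x"
    using xc unitary_right[OF x] by (simp add: D_def mat_minus_mult)
  then have adjD: "adj D = - (D * adj x)"
    using xc unfolding D_def by (auto simp: adj_minus intro!: eq_matI)
  have "A * (L * (D * adj x)) = D * adj x"
    using mat_mult_assoc[of "A" "L * D" "adj x"] mat_mult_assoc[of L D "adj x"] A L D xc ALD by simp
  then have "A * (L * adj D) = adj D"
    using A L D xc by (simp add: adjD)
  from arg_cong[OF this, of adj] have "D * adj L * adj A = D"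
    using A L D by (simp add: adj_mult)
  then have "A * (L * D * adj L) * adj A = A * (L * D)"
    using A L D by (simp add: mat_mult_assoc)
  then have "wall A (L * D * adj L) = 1\<^sub>m n + D"
    using A by (simp add: wall_def ALD)
  also have "\<dots> = x"
    using xc unfolding D_def by (intro eq_matI) auto
  finally show ?thesis
    by (simp add: D_def)
qed

text \<open>
  The condition makes the columns of \<open>A\<close> a basis of \<open>im (x - 1) + im (y - 1)\<close> when
  \<open>x = wall A S\<close> and \<open>y = wall A T\<close>.
\<close>

definition good_pair :: "nat \<Rightarrow> 'k mat \<Rightarrow> 'k mat \<Rightarrow> bool" where
  "good_pair d S T \<longleftrightarrow> S \<in> carrier_mat d d \<and> T \<in> carrier_mat d d \<and>
     (\<exists>X\<in>carrier_mat d d. \<exists>Y\<in>carrier_mat d d. S * X + T * Y = 1\<^sub>m d)"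

lemma unitary_pair_wall:
  assumes x: "x \<in> unitary_group q n" and y: "y \<in> unitary_group q n"
  obtains r A S T where "linj n r A" "good_pair r S T" "x = wall A S" "y = wall A T"
proof -
  have xy: "x \<in> carrier_mat n n" "y \<in> carrier_mat n n"
    using x y by (simp_all add: unitary_group_iff)
  define D E where "D = x - 1\<^sub>m n" and "E = y - 1\<^sub>m n"
  have DE: "D \<in> carrier_mat n n" "E \<in> carrier_mat n n"
    unfolding D_def E_def by (auto intro!: minus_carrier_mat)
  have M: "hcat D E \<in> carrier_mat n (n + n)"
    using DE by (intro hcat_carrier)
  obtain r K Z where K: "K \<in> carrier_mat (n + n) r" "linj n r (hcat D E * K)" "Z \<in> carrier_mat r (n + n)"
    "hcat D E = hcat D E * K * Z"
    using rank_factorization[OF M] .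
  define A where "A = hcat D E * K"
  have linA: "linj n r A" and A: "A \<in> carrier_mat n r"
    using K(2) linj_carrier by (simp_all add: A_def)
  obtain L where L: "L \<in> carrier_mat r n" "L * A = 1\<^sub>m r"
    using linA by (auto simp: linj_def)
  have "A * (L * (A * Z)) = A * Z"
    using A L K(3) by (simp add: mat_left_cancel)
  then have "A * (L * hcat D E) = hcat D E"
    using K(4) by (simp add: A_def)
  then have "hcat (A * (L * D)) (A * (L * E)) = hcat D E"
    using A L DE by (simp add: mult_hcat)
  then have ALDE: "A * (L * D) = D" "A * (L * E) = E"
    using A L DE by (simp_all add: hcat_eq_iff[of _ n])
  define S T where "S = L * D * adj L" and "T = L * E * adj L"
  have ST: "S \<in> carrier_mat r r" "T \<in> carrier_mat r r"
    using L DE by (auto simp: S_def T_def)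
  have walls: "x = wall A S" "y = wall A T"
    using wall_of_unitary[OF x A L(1)] wall_of_unitary[OF y A L(1)] ALDE
    by (simp_all add: S_def T_def D_def E_def)
  have cancel_one: "wall A U - 1\<^sub>m n = A * U * adj A" if "U \<in> carrier_mat r r" for U
    using A that by (intro eq_matI) (auto simp: wall_def simp del: index_mult_mat(1))
  have DE_eq: "D = A * S * adj A" "E = A * T * adj A"
    using cancel_one[OF ST(1)] cancel_one[OF ST(2)] walls by (simp_all add: D_def E_def)
  \<comment> \<open>The blocks of \<open>K\<close> write \<open>A\<close> as
    \<open>D * K1 + E * K2\<close>; cancelling \<open>A\<close> on the left turns this into the
    identity required by \<open>good_pair\<close>.\<close>
  obtain K1 K2 where K12: "K1 \<in> carrier_mat n r" "K2 \<in> carrier_mat n r" "K = vcat K1 K2"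
    using vcat_split[OF K(1)] .
  have "A * 1\<^sub>m r = D * K1 + E * K2"
    using A DE K12 by (simp add: A_def hcat_vcat_mult)
  also have "\<dots> = A * (S * (adj A * K1) + T * (adj A * K2))"
    unfolding DE_eq using A ST K12 by (simp add: mat_mult_add mat_mult_assoc)
  finally have "1\<^sub>m r = S * (adj A * K1) + T * (adj A * K2)"
    by (rule linj_cancel[OF linA, rotated 2]) (use A ST K12 in auto)
  then have "good_pair r S T"
    unfolding good_pair_def using A ST K12 by (metis adj_carrier mult_carrier_mat)
  then show ?thesis
    using that linA walls by blast
qed

text \<open>As \<open>adj A\<close> is onto, the factors \<open>X\<close> and \<open>Y\<close> from
  \<open>good_pair\<close> lift through it. The columns of \<open>A\<close> are thus recovered from
  \<open>wall A S - 1\<close> and \<open>wall A T - 1\<close>, which makes \<open>A\<close> minimal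
  among all presentations of the pair.\<close>

lemma good_pair_columns:
  assumes A: "linj n r A" and good: "good_pair r S T"
  obtains X Y where "X \<in> carrier_mat n r" "Y \<in> carrier_mat n r"
    "A = A * S * adj A * X + A * T * adj A * Y"
proof -
  note Ac = linj_carrier[OF A]
  obtain X Y where XY: "S \<in> carrier_mat r r" "T \<in> carrier_mat r r" "X \<in> carrier_mat r r" "Y \<in> carrier_mat r r"
    "S * X + T * Y = 1\<^sub>m r"
    using good by (auto simp: good_pair_def)
  obtain X' Y' where X': "X' \<in> carrier_mat n r" "adj A * X' = X" and Y': "Y' \<in> carrier_mat n r" "adj A * Y' = Y"
    using adj_linj_solution[OF A XY(3)] adj_linj_solution[OF A XY(4)] by metis
  have "A * S * adj A * X' + A * T * adj A * Y' = A * (S * X + T * Y)"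
    using Ac XY(1-4) X' Y' by (simp add: mat_mult_assoc mat_mult_add)
  also have "\<dots> = A"
    using XY(5) Ac by simp
  finally show ?thesis
    using that X'(1) Y'(1) by simp
qed

lemma wall_eqD:
  assumes "wall A S = wall B T" "A \<in> carrier_mat n a" "B \<in> carrier_mat n b"
    "S \<in> carrier_mat a a" "T \<in> carrier_mat b b"
  shows "A * S * adj A = B * T * adj B"
proof -
  have "1\<^sub>m n + A * S * adj A = 1\<^sub>m n + B * T * adj B"
    using assms(1-3) by (simp add: wall_def)
  then show ?thesis
    by (rule mat_add_left_cancel) (use assms(2-) in auto)
qed

lemma good_pair_factor:
  assumes A: "linj n r A" and good: "good_pair r S T"
    and B: "B \<in> carrier_mat n d" "S' \<in> carrier_mat d d" "T' \<in> carrier_mat d d"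
    and eq: "wall A S = wall B S'" "wall A T = wall B T'"
  obtains Q where "Q \<in> carrier_mat d r" "A = B * Q"
proof -
  have ST: "S \<in> carrier_mat r r" "T \<in> carrier_mat r r"
    using good by (auto simp: good_pair_def)
  note Ac = linj_carrier[OF A]
  obtain X Y where XY: "X \<in> carrier_mat n r" "Y \<in> carrier_mat n r"
    "A = A * S * adj A * X + A * T * adj A * Y"
    using good_pair_columns[OF A good] .
  have "A * S * adj A * X + A * T * adj A * Y = B * S' * adj B * X + B * T' * adj B * Y"
    using wall_eqD[OF eq(1) Ac B(1) ST(1) B(2)] wall_eqD[OF eq(2) Ac B(1) ST(2) B(3)] by simp
  also have "\<dots> = B * (S' * adj B * X + T' * adj B * Y)"
    using B XY(1,2) by (simp add: mat_mult_assoc mat_mult_add)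
  finally have "A = B * (S' * adj B * X + T' * adj B * Y)"
    using XY(3) by simp
  then show ?thesis
    using that[of "S' * adj B * X + T' * adj B * Y"] B XY(1,2) by auto
qed

text \<open>Even if \<open>B\<close> presents only the first element and \<open>C\<close> only the
  second, their columns together span those of \<open>A\<close>. This bounds the dimension by data
  of the two types, whatever \<open>n\<close> is.\<close>

lemma good_pair_dim_le:
  assumes A: "linj n r A" and good: "good_pair r S T"
    and B: "B \<in> carrier_mat n a" "S' \<in> carrier_mat a a" and C: "C \<in> carrier_mat n b" "T' \<in> carrier_mat b b"
    and eq: "wall A S = wall B S'" "wall A T = wall C T'"
  shows "r \<le> a + b"
proof -
  have ST: "S \<in> carrier_mat r r" "T \<in> carrier_mat r r"
    using good by (auto simp: good_pair_def)
  note Ac = linj_carrier[OF A]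
  obtain X Y where XY: "X \<in> carrier_mat n r" "Y \<in> carrier_mat n r"
    "A = A * S * adj A * X + A * T * adj A * Y"
    using good_pair_columns[OF A good] .
  let ?P = "S' * adj B * X" and ?Q = "T' * adj C * Y"
  have "A * S * adj A * X + A * T * adj A * Y = B * S' * adj B * X + C * T' * adj C * Y"
    using wall_eqD[OF eq(1) Ac B(1) ST(1) B(2)] wall_eqD[OF eq(2) Ac C(1) ST(2) C(2)] by simp
  also have "\<dots> = B * ?P + C * ?Q"
    using B C XY(1,2) by (simp add: mat_mult_assoc)
  also have "\<dots> = hcat B C * vcat ?P ?Q"
    using B C XY(1,2) by (subst hcat_vcat_mult) auto
  finally have "A = hcat B C * vcat ?P ?Q"
    using XY(3) by simp
  then have "linj n r (hcat B C * vcat ?P ?Q)"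
    using A by (rule subst)
  moreover have "?P \<in> carrier_mat a r" "?Q \<in> carrier_mat b r"
    using B C XY(1,2) by auto
  ultimately have "linj (a + b) r (vcat ?P ?Q)"
    using linj_right_factor hcat_carrier[OF B(1) C(1)] vcat_carrier by blast
  then show ?thesis
    by (rule linj_dim_le)
qed

text \<open>A single element is treated as a pair with the identity, whose coefficient matrix must
  be zero; \<open>good_pair\<close> then says that \<open>R\<close> is right invertible, so the
  columns of \<open>A\<close> form a basis of the image of \<open>g - 1\<close>.\<close>

lemma unitary_wall:
  assumes "g \<in> unitary_group q n"
  obtains e A R X where "linj n e A" "R \<in> carrier_mat e e" "X \<in> carrier_mat e e" "R * X = 1\<^sub>m e" "g = wall A R"
proof -
  have one: "(1\<^sub>m n :: 'k mat) \<in> unitary_group q n"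
    by (simp add: unitary_group_iff)
  obtain e A R T where A: "linj n e A" "good_pair e R T" "g = wall A R" "1\<^sub>m n = wall A T"
    using unitary_pair_wall[OF assms one] .
  have RT: "R \<in> carrier_mat e e" "T \<in> carrier_mat e e"
    using A(2) by (auto simp: good_pair_def)
  have "T = 0\<^sub>m e e"
    using wall_inject[OF A(1) RT(2), of "0\<^sub>m e e"] A(4) wall_zero[OF linj_carrier[OF A(1)]] by simp
  then obtain X where "X \<in> carrier_mat e e" "R * X = 1\<^sub>m e"
    using A(2) RT by (auto simp: good_pair_def)
  then show ?thesis
    using that A RT by blast
qed

text \<open>After padding by zero rows both \<open>A\<close> and \<open>A'\<close> live in dimension
  \<open>n + n'\<close>, where Witt's theorem gives an isometry between them; conjugating by it
  carries one \<open>wall\<close> to the other.\<close>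

lemma same_modtype_wall:
  assumes A: "linj n d A" and A': "linj n' d A'" and gram: "adj A * A = adj A' * A'"
    and S: "S \<in> carrier_mat d d" and unitary: "wall A S \<in> unitary_group q n"
  shows "same_modtype q (wall A S) (wall A' S)"
proof -
  note c = linj_carrier[OF A] linj_carrier[OF A']
  have unitary': "wall A' S \<in> unitary_group q n'"
    using unitary by (simp add: wall_unitary_iff[OF A S] wall_unitary_iff[OF A' S] gram)
  have 1: "linj (n + n') d (vcat A (0\<^sub>m n' d))"
    using vcat_linj[OF c(1)] A by blast
  have 2: "linj (n + n') d (vcat A' (0\<^sub>m n d))"
    using vcat_linj[OF c(2), of n] A' by (simp add: add.commute)
  obtain h where h: "h \<in> unitary_group q (n + n')" "h * vcat A (0\<^sub>m n' d) = vcat A' (0\<^sub>m n d)"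
    using witt_extension[OF 1 2] gram_vcat_zero[OF c(1)] gram_vcat_zero[OF c(2)] gram by auto
  have "embed_mat (n + n') (wall A' S) = wall (vcat A' (0\<^sub>m n d)) S"
    using embed_wall[OF c(2) S, of n] by (simp add: add.commute)
  also have "\<dots> = h * embed_mat (n + n') (wall A S) * adj h"
    using wall_conj[OF h(1) linj_carrier[OF 1] S] h(2) embed_wall[OF c(1) S] by simp
  finally have conj: "embed_mat (n + n') (wall A' S) = h * embed_mat (n + n') (wall A S) * adj h" .
  have "h * adj h = 1\<^sub>m (n + n')" "adj h * h = 1\<^sub>m (n + n')"
    using h(1) unitary_right by (auto simp: unitary_group_iff)
  moreover have "dim_row (wall A S) = n" "dim_row (wall A' S) = n'"
    using wall_carrier c by blast+
  ultimately show ?thesis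
    unfolding same_modtype_def using unitary unitary' h(1) conj by (metis le_add1 le_add2)
qed

text \<open>Converse to \<open>same_modtype_wall\<close>. The conjugated frame \<open>B\<close>
  spans the image of the padded \<open>g' - 1\<close>, whose last \<open>k'\<close> rows vanish;
  hence so do those of \<open>B\<close>, and its upper part \<open>A'\<close> presents
  \<open>g'\<close> already in dimension \<open>n'\<close>.\<close>

lemma same_modtype_wallE:
  assumes same: "same_modtype q (wall A R) g'" and A: "linj n e A"
    and R: "R \<in> carrier_mat e e" "X \<in> carrier_mat e e" "R * X = 1\<^sub>m e"
    and g': "g' \<in> unitary_group q n'"
  obtains A' where "linj n' e A'" "adj A' * A' = adj A * A" "g' = wall A' R"
proof -
  note Ac = linj_carrier[OF A]
  have g'c: "g' \<in> carrier_mat n' n'"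
    using g' by (simp add: unitary_group_iff)
  have dims: "dim_row (wall A R) = n" "dim_row g' = n'"
    using wall_carrier[OF Ac] g'c by auto
  obtain N h h' where N: "n \<le> N" "n' \<le> N" and h: "h \<in> unitary_group q N" "h * h' = 1\<^sub>m N" "h' * h = 1\<^sub>m N"
    and conj: "embed_mat N g' = h * embed_mat N (wall A R) * h'"
    using same unfolding same_modtype_def dims by blast
  define k k' where "k = N - n" and "k' = N - n'"
  have N_eq: "N = n + k" "N = n' + k'"
    using N by (simp_all add: k_def k'_def)
  have hc: "h \<in> carrier_mat N N"
    using h(1) by (simp add: unitary_group_iff)
  have h'c: "h' \<in> carrier_mat N N"
    using hc h(2,3) by (metis carrier_matI carrier_matD index_mult_mat(2,3) index_one_mat(2,3))
  have "adj h * (h * h') = h'"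
    using h(1) hc h'c by (intro mat_left_cancel[of _ _ N]) (auto simp: unitary_group_iff)
  then have h': "h' = adj h"
    using h(2) hc by simp
  define V where "V = vcat A (0\<^sub>m k e)"
  define B where "B = h * V"
  have pad: "linj N e V"
    using vcat_linj[OF Ac] A by (simp add: N_eq(1) V_def)
  have "linj N N h"
    using h hc h'c by (auto simp: linj_def)
  then have B: "linj N e B"
    unfolding B_def using pad by (rule linj_mult)
  note Bc = linj_carrier[OF B]
  define M where "M = g' - 1\<^sub>m n'"
  have M: "M \<in> carrier_mat n' n'"
    unfolding M_def by (rule minus_carrier_mat) simp
  have g'_eq: "g' = 1\<^sub>m n' + M"
    using g'c unfolding M_def by (intro eq_matI) auto
  have "embed_mat N g' = wall B R"
    using conj embed_wall[OF Ac R(1), of k] wall_conj[OF h(1) linj_carrier[OF pad] R(1)]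
    by (simp add: B_def V_def h' N_eq(1))
  then have "1\<^sub>m N + corner k' M = 1\<^sub>m N + B * R * adj B"
    using embed_eq_corner[OF M, of k'] Bc by (simp add: g'_eq N_eq(2) wall_def)
  then have corner: "corner k' M = B * R * adj B"
    by (rule mat_add_left_cancel) (use Bc R(1) corner_carrier[OF M, of k'] N_eq(2) in auto)
  \<comment> \<open>Multiplying \<open>B * R * adj B\<close> by this \<open>Z\<close> gives
    \<open>B * R * X = B\<close>; this is where right invertibility of \<open>R\<close>
    enters.\<close>
  obtain Z where Z: "Z \<in> carrier_mat N e" "adj B * Z = X"
    using adj_linj_solution[OF B R(2)] .
  have "corner k' M * Z = B"
    using corner Bc R Z by (simp add: mat_mult_assoc)
  then have B_eq: "B = vcat (hcat M (0\<^sub>m n' k') * Z) (0\<^sub>m k' e)"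
    unfolding corner_def using M Z(1) by (subst (asm) vcat_mult) (auto simp: N_eq(2))
  define A' where "A' = hcat M (0\<^sub>m n' k') * Z"
  have A'c: "A' \<in> carrier_mat n' e"
    unfolding A'_def using M Z(1) by (auto simp: N_eq(2))
  have B_pad: "B = vcat A' (0\<^sub>m k' e)"
    by (simp add: B_eq A'_def)
  have "linj n' e A'"
    using B vcat_linj[OF A'c, of k'] by (simp add: B_pad N_eq(2))
  moreover have "adj A' * A' = adj A * A"
  proof -
    have "adj A' * A' = adj B * B"
      using gram_vcat_zero[OF A'c] by (simp add: B_pad)
    also have "\<dots> = adj V * (adj h * (h * V))"
      using hc linj_carrier[OF pad] unfolding B_def by (simp add: adj_mult mat_mult_assoc)
    also have "adj h * (h * V) = V"
      using h(1) hc linj_carrier[OF pad] by (intro mat_left_cancel[of _ _ N]) (auto simp: unitary_group_iff)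
    finally show ?thesis
      by (simp add: gram_vcat_zero[OF Ac] V_def)
  qed
  moreover have "M = A' * R * adj A'"
    using corner vcat_zero_conj[OF A'c R(1), of k'] M A'c
    by (simp add: B_pad) (subst (asm) corner_inject[of _ n' n']; auto)
  then have "g' = wall A' R"
    using g'_eq A'c by (simp add: wall_def)
  ultimately show ?thesis
    using that by blast
qed

lemma same_modtype_unitary:
  fixes g :: "'k mat"
  assumes "same_modtype q g g'"
  obtains n n' where "g \<in> unitary_group q n" "g' \<in> unitary_group q n'"
  using assms by (auto simp: same_modtype_def)

lemma same_modtype_refl:
  fixes g :: "'k mat"
  assumes g: "g \<in> unitary_group q n"
  shows "same_modtype q g g"
proof -
  obtain e A R X where A: "linj n e A" "R \<in> carrier_mat e e" "g = wall A R"
    using unitary_wall[OF g] by blast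
  then show ?thesis
    using same_modtype_wall[OF A(1) A(1) refl A(2)] g by simp
qed

lemma same_modtype_sym:
  fixes g :: "'k mat"
  assumes "same_modtype q g g'"
  shows "same_modtype q g' g"
proof -
  obtain n n' where u: "g \<in> unitary_group q n" "g' \<in> unitary_group q n'"
    using same_modtype_unitary[OF assms] .
  obtain e A R X where A: "linj n e A" "R \<in> carrier_mat e e" "X \<in> carrier_mat e e" "R * X = 1\<^sub>m e" "g = wall A R"
    using unitary_wall[OF u(1)] .
  obtain A' where "linj n' e A'" "adj A' * A' = adj A * A" "g' = wall A' R"
    using same_modtype_wallE[OF assms[unfolded A(5)] A(1-4) u(2)] .
  then show ?thesis
    using same_modtype_wall[of n' e A' n A R] A u by simp
qed

text \<open>The two conjugations may take place in groups of different sizes. Passing through a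
  common coefficient matrix \<open>R\<close> and equal Gram matrices avoids comparing them.\<close>

lemma same_modtype_trans:
  fixes g :: "'k mat"
  assumes "same_modtype q g g'" "same_modtype q g' g''"
  shows "same_modtype q g g''"
proof -
  obtain n n' where u: "g \<in> unitary_group q n" "g' \<in> unitary_group q n'"
    using same_modtype_unitary[OF assms(1)] .
  obtain n'' where u'': "g'' \<in> unitary_group q n''"
    using same_modtype_unitary[OF assms(2)] .
  obtain e A R X where A: "linj n e A" "R \<in> carrier_mat e e" "X \<in> carrier_mat e e" "R * X = 1\<^sub>m e" "g = wall A R"
    using unitary_wall[OF u(1)] .
  obtain A' where A': "linj n' e A'" "adj A' * A' = adj A * A" "g' = wall A' R"
    using same_modtype_wallE[OF assms(1)[unfolded A(5)] A(1-4) u(2)] .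
  obtain A'' where "linj n'' e A''" "adj A'' * A'' = adj A' * A'" "g'' = wall A'' R"
    using same_modtype_wallE[OF assms(2)[unfolded A'(3)] A'(1) A(2-4) u''] .
  then show ?thesis
    using same_modtype_wall[of n e A n'' A'' R] A A' u by simp
qed

section \<open>Polynomials with values in \<open>\<int>[1/q]\<close>\<close>

lemma qint_0 [simp]: "qint q 0 = 0"
  by (simp add: qint_def)

lemma mq_neq_1: "mq - 1 \<noteq> 0"
  using q_gt_1 by (simp add: algebra_simps)

lemma qint_Suc: "qint q (Suc n) = 1 + mq * qint q n"
  using mq_neq_1 by (simp add: qint_def field_simps)

lemma mq_power_eq: "mq ^ n = 1 + (mq - 1) * qint q n"
  using mq_neq_1 by (simp add: qint_def)

lemma qint_Suc_neq_0: "qint q (Suc n) \<noteq> 0"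
proof
  assume "qint q (Suc n) = 0"
  then have "mq ^ Suc n = 1"
    using mq_power_eq[of "Suc n"] by simp
  then have "\<bar>mq ^ Suc n\<bar> = 1"
    by simp
  then have "rat_of_nat (q ^ Suc n) = 1"
    by (simp add: power_abs abs_mult)
  then have "q ^ Suc n = 1"
    by (simp only: of_nat_eq_1_iff)
  then show False
    using q_gt_1 by (simp add: nat_power_eq_Suc_0_iff)
qed

lemma qint_inject: "qint q n = qint q m \<longleftrightarrow> n = m"
proof (induction n arbitrary: m)
  case 0
  show ?case
    using qint_Suc_neq_0[of "m - 1"] by (cases m) auto
next
  case (Suc n)
  show ?case
    using qint_Suc_neq_0[of n] q_gt_1 Suc.IH by (cases m) (auto simp: qint_Suc)
qed

section \<open>Arithmetic with powers of q as denominators\<close>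

lemma laurent_intI: "c = of_int a / of_nat q ^ m \<Longrightarrow> laurent_int q c"
  by (auto simp: laurent_int_def)

lemma laurent_of_int [simp]: "laurent_int q (of_int a)"
  by (rule laurent_intI[of _ a 0]) simp

lemma laurent_of_nat [simp]: "laurent_int q (of_nat a)"
  using laurent_of_int[of "int a"] by simp

lemma laurent_0 [simp]: "laurent_int q 0" and laurent_1 [simp]: "laurent_int q 1"
  using laurent_of_int[of 0] laurent_of_int[of 1] by simp_all

lemma laurent_mult: "laurent_int q a \<Longrightarrow> laurent_int q b \<Longrightarrow> laurent_int q (a * b)"
proof -
  assume "laurent_int q a" "laurent_int q b"
  then obtain x m y k where "a = of_int x / of_nat q ^ m" "b = of_int y / of_nat q ^ k"
    by (auto simp: laurent_int_def)
  then show ?thesis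
    by (intro laurent_intI[of _ "x * y" "m + k"]) (simp add: power_add)
qed

lemma laurent_add: "laurent_int q a \<Longrightarrow> laurent_int q b \<Longrightarrow> laurent_int q (a + b)"
proof -
  assume "laurent_int q a" "laurent_int q b"
  then obtain x m y k where "a = of_int x / of_nat q ^ m" "b = of_int y / of_nat q ^ k"
    by (auto simp: laurent_int_def)
  moreover have "rat_of_nat q ^ m \<noteq> 0" "rat_of_nat q ^ k \<noteq> 0"
    using q_gt_1 by simp_all
  ultimately have "a + b = (of_int x * of_nat q ^ k + of_int y * of_nat q ^ m) / (of_nat q ^ m * of_nat q ^ k)"
    by (metis add_frac_eq)
  then show ?thesis
    by (intro laurent_intI[of _ "x * int q ^ k + y * int q ^ m" "m + k"]) (simp add: power_add)
qed

lemma laurent_uminus: "laurent_int q a \<Longrightarrow> laurent_int q (- a)"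
  using laurent_mult[OF laurent_of_int[of "-1"]] by simp

lemma laurent_diff: "laurent_int q a \<Longrightarrow> laurent_int q b \<Longrightarrow> laurent_int q (a - b)"
  using laurent_add[OF _ laurent_uminus] by fastforce

lemma laurent_power: "laurent_int q a \<Longrightarrow> laurent_int q (a ^ n)"
  by (induction n) (auto intro: laurent_mult)

lemma laurent_sum: "(\<And>i. i \<in> I \<Longrightarrow> laurent_int q (f i)) \<Longrightarrow> laurent_int q (sum f I)"
  by (induction I rule: infinite_finite_induct) (auto intro: laurent_add)

lemma laurent_divide_mq_power: "laurent_int q a \<Longrightarrow> laurent_int q (a / mq ^ n)"
proof -
  have "1 / mq = of_int (- 1) / of_nat q ^ 1"
    by simp
  then have "laurent_int q (1 / mq)"
    by (rule laurent_intI)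
  then have "laurent_int q ((1 / mq) ^ n)"
    by (rule laurent_power)
  moreover have "a / mq ^ n = a * (1 / mq) ^ n"
    by (simp only: power_one_over times_divide_eq_right mult_1_right)
  ultimately show "laurent_int q a \<Longrightarrow> ?thesis"
    by (simp only: laurent_mult)
qed

text \<open>
  Since \<open>[n + 1] = 1 - q [n]\<close>, the polynomial \<open>p(1 - q x) - (-q)\<^sup>D p(x)\<close> with \<open>D = degree p\<close> has
  smaller degree and expresses the value of \<open>p\<close> at \<open>[n]\<close> through that at \<open>[n + 1]\<close>.
\<close>

lemma laurent_extend_backwards:
  assumes "\<And>n. n \<ge> n0 \<Longrightarrow> laurent_int q (poly p (qint q n))"
  shows "laurent_int q (poly p (qint q n))"
  using assms
proof (induction "degree p" arbitrary: p n rule: less_induct)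
  case less
  show ?case
  proof (cases "degree p = 0")
    case True
    then obtain c where "p = [:c:]"
      by (elim degree_eq_zeroE)
    then show ?thesis
      using less.prems[of n0] by simp
  next
    case False
    let ?l = "[:1, mq:]"
    have deg_l: "degree ?l = 1"
      using q_gt_1 by simp
    define p1 where "p1 = pcompose p ?l - smult (mq ^ degree p) p"
    have deg_comp: "degree (pcompose p ?l) = degree p"
      by (simp only: degree_pcompose deg_l mult_1_right)
    have "coeff (pcompose p ?l) (degree p) = lead_coeff p * mq ^ degree p"
      using lead_coeff_comp[of ?l p] deg_l deg_comp by (simp add: q_gt_1)
    then have "coeff p1 (degree p) = 0"
      by (simp add: p1_def)
    moreover have "degree p1 \<le> degree p"
      unfolding p1_def by (intro degree_diff_le) (simp_all only: deg_comp degree_smult_le order_refl)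
    ultimately have deg: "degree p1 < degree p"
      using False by (metis degree_0 degree_less_if_less_eqI neq0_conv)
    have p1: "poly p1 (qint q n) = poly p (qint q (Suc n)) - mq ^ degree p * poly p (qint q n)" for n
      by (simp add: p1_def poly_pcompose qint_Suc mult.commute)
    have lp1: "laurent_int q (poly p1 (qint q n))" for n
      using deg
    proof (rule less.hyps)
      show "laurent_int q (poly p1 (qint q n))" if "n \<ge> n0" for n
        unfolding p1 using that by (intro laurent_diff laurent_mult laurent_power laurent_uminus less.prems) auto
    qed
    \<comment> \<open>Passing from \<open>n + 1\<close> down to \<open>n\<close> divides by a power
      of \<open>mq\<close>, which is possible because \<open>q\<close> is a unit in the coefficient
      ring.\<close>
    have descend: "laurent_int q (poly p (qint q n))" if "laurent_int q (poly p (qint q (Suc n)))" for n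
    proof -
      have "poly p (qint q n) = (poly p (qint q (Suc n)) - poly p1 (qint q n)) / mq ^ degree p"
        using p1[of n] q_gt_1 by (simp add: field_simps)
      then show ?thesis
        using laurent_divide_mq_power[OF laurent_diff[OF that lp1]] by metis
    qed
    show ?thesis
    proof (cases "n \<ge> n0")
      case False
      then have "n \<le> n0"
        by simp
      then show ?thesis
        by (induction rule: inc_induct) (use less.prems descend in auto)
    qed (rule less.prems)
  qed
qed

section \<open>Gaussian binomials with base -q as polynomials in [n]\<close>

lemma poly_qbinom_Suc:
  "poly (qbinom_poly q (Suc k)) x = poly (qbinom_poly q k) x * (x - qint q k) / (mq ^ k * qint q (Suc k))"
proof -
  have "Suc k * k div 2 = k + k * (k - 1) div 2"
    by (cases k) simp_all
  moreover have "qfact q (Suc k) = qfact q k * qint q (Suc k)"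
    by (simp add: qfact_def mult.commute)
  ultimately show ?thesis
    by (simp add: qbinom_poly_def poly_prod power_add field_simps)
qed

lemma poly_qbinom_0 [simp]: "qbinom_poly q 0 = 1"
  by (simp add: qbinom_poly_def qfact_def)

text \<open>The q-Pascal rule for base \<open>-q\<close>. It is derived from an absorption identity
  that holds for every \<open>y\<close>, not only at the nodes; the shift \<open>1 + mq * y\<close>
  sends node \<open>qint q n\<close> to node \<open>qint q (Suc n)\<close>.\<close>

lemma poly_qbinom_pascal:
  "poly (qbinom_poly q (Suc k)) (qint q (Suc n)) =
     poly (qbinom_poly q k) (qint q n) + mq ^ Suc k * poly (qbinom_poly q (Suc k)) (qint q n)"
proof -
  have mq: "mq ^ k \<noteq> 0" for k
    using q_gt_1 by simp
  have *: "poly (qbinom_poly q (Suc k)) (1 + mq * y) * qint q (Suc k) = (1 + mq * y) * poly (qbinom_poly q k) y" for k y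
  proof (induction k)
    case 0
    show ?case
      by (simp add: poly_qbinom_Suc qint_Suc)
  next
    case (Suc k)
    have "poly (qbinom_poly q (Suc (Suc k))) (1 + mq * y) * qint q (Suc (Suc k)) =
        poly (qbinom_poly q (Suc k)) (1 + mq * y) * (mq * y - mq * qint q k) / (mq * mq ^ k)"
      using qint_Suc_neq_0[of "Suc k"] by (subst poly_qbinom_Suc) (simp add: qint_Suc[of k])
    also have "\<dots> = poly (qbinom_poly q (Suc k)) (1 + mq * y) * (y - qint q k) / mq ^ k"
      using q_gt_1 by (simp add: field_simps)
    also have "\<dots> = (1 + mq * y) * poly (qbinom_poly q k) y / qint q (Suc k) * (y - qint q k) / mq ^ k"
      using Suc.IH qint_Suc_neq_0[of k] by (metis nonzero_mult_div_cancel_right)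
    also have "\<dots> = (1 + mq * y) * poly (qbinom_poly q (Suc k)) y"
      by (simp add: poly_qbinom_Suc mult_ac)
    finally show ?case .
  qed
  let ?B = "poly (qbinom_poly q k) (qint q n)"
  have "(?B + mq ^ Suc k * poly (qbinom_poly q (Suc k)) (qint q n)) * qint q (Suc k) =
      ?B * (qint q (Suc k) + mq * (qint q n - qint q k))"
    using qint_Suc_neq_0[of k] mq[of k] by (simp add: poly_qbinom_Suc field_simps)
  also have "\<dots> = qint q (Suc n) * ?B"
    by (simp add: qint_Suc algebra_simps)
  also have "\<dots> = poly (qbinom_poly q (Suc k)) (qint q (Suc n)) * qint q (Suc k)"
    using *[of k "qint q n"] by (simp add: qint_Suc[of n])
  finally show ?thesis
    using qint_Suc_neq_0[of k] by simp
qed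

lemma poly_qbinom_less: "i < k \<Longrightarrow> poly (qbinom_poly q k) (qint q i) = 0"
  by (auto simp: qbinom_poly_def poly_prod intro!: prod_zero bexI[of _ i])

lemma laurent_qbinom: "laurent_int q (poly (qbinom_poly q k) (qint q n))"
proof (induction n arbitrary: k)
  case 0
  show ?case
    using poly_qbinom_less[of 0 k] by (cases k) (simp_all del: qint_0)
next
  case (Suc n)
  show ?case
    by (cases k) (auto simp only: poly_qbinom_0 poly_1 laurent_1 poly_qbinom_pascal
      intro!: laurent_add laurent_mult laurent_power laurent_uminus laurent_of_nat Suc.IH)
qed

lemma poly_qbinom_self: "poly (qbinom_poly q k) (qint q k) = 1"
  by (induction k) (simp_all add: poly_qbinom_pascal poly_qbinom_less)

lemma degree_qbinom_le: "degree (qbinom_poly q k) \<le> k"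
proof -
  have "degree (\<Prod>i<k. [:- qint q i, 1:]) \<le> k"
    using degree_prod_sum_le[of "{..<k}" "\<lambda>i. [:- qint q i, 1:]"] by simp
  then show ?thesis
    unfolding qbinom_poly_def by (rule order.trans[OF degree_smult_le])
qed

text \<open>Newton interpolation: \<open>qbinom_poly q k\<close> is 1 at node \<open>k\<close> and
  vanishes at all earlier nodes, so the coefficients are found one after the other without any
  division. Values at all nodes are available because \<open>laurent_extend_backwards\<close> fills
  in those below \<open>n0\<close>.\<close>

lemma R_minus_qI:
  assumes "\<And>n. n \<ge> n0 \<Longrightarrow> laurent_int q (poly p (qint q n))"
  shows "p \<in> R_minus_q q"
proof -
  have lp: "laurent_int q (poly p (qint q n))" for n
    using laurent_extend_backwards[OF assms] .
  have "\<exists>c. (\<forall>k. laurent_int q (c k)) \<and>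
      (\<forall>n<K. poly (\<Sum>k<K. smult (c k) (qbinom_poly q k)) (qint q n) = poly p (qint q n))" for K
  proof (induction K)
    case 0
    show ?case
      by (intro exI[of _ "\<lambda>_. 0"]) simp
  next
    case (Suc K)
    then obtain c where c: "\<And>k. laurent_int q (c k)"
      "\<And>n. n < K \<Longrightarrow> poly (\<Sum>k<K. smult (c k) (qbinom_poly q k)) (qint q n) = poly p (qint q n)"
      by blast
    let ?s = "\<Sum>k<K. smult (c k) (qbinom_poly q k)"
    \<comment> \<open>The new coefficient is the interpolation error at node \<open>K\<close>; the
      new term leaves all earlier nodes alone.\<close>
    define c' where "c' = c(K := poly p (qint q K) - poly ?s (qint q K))"
    have "laurent_int q (poly p (qint q K) - poly ?s (qint q K))"
      by (auto simp: poly_sum intro!: laurent_diff lp laurent_sum laurent_mult c(1) laurent_qbinom)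
    then have "laurent_int q (c' k)" for k
      using c(1) by (simp add: c'_def)
    moreover have sum: "(\<Sum>k<Suc K. smult (c' k) (qbinom_poly q k)) = ?s + smult (c' K) (qbinom_poly q K)"
      by (simp add: c'_def)
    have "poly (\<Sum>k<Suc K. smult (c' k) (qbinom_poly q k)) (qint q n) = poly p (qint q n)" if "n < Suc K" for n
      unfolding sum using c(2)[of n] that
      by (cases "n = K") (simp_all add: poly_qbinom_self poly_qbinom_less c'_def)
    ultimately show ?case
      by blast
  qed
  then obtain c where c: "\<And>k. laurent_int q (c k)"
    "\<And>n. n < Suc (degree p) \<Longrightarrow>
      poly (\<Sum>k<Suc (degree p). smult (c k) (qbinom_poly q k)) (qint q n) = poly p (qint q n)"
    by blast
  let ?s = "\<Sum>k<Suc (degree p). smult (c k) (qbinom_poly q k)"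
  have "degree ?s \<le> degree p"
  proof (rule degree_sum_le)
    fix k
    assume "k \<in> {..<Suc (degree p)}"
    then have "k \<le> degree p"
      by simp
    then show "degree (smult (c k) (qbinom_poly q k)) \<le> degree p"
      by (rule order.trans[OF order.trans[OF degree_smult_le degree_qbinom_le]])
  qed simp
  have "?s = p"
  proof (rule ccontr)
    assume "?s \<noteq> p"
    then have ne: "?s - p \<noteq> 0"
      by simp
    have "card (qint q ` {..<Suc (degree p)}) \<le> card {x. poly (?s - p) x = 0}"
      using c(2) poly_roots_finite[OF ne] by (intro card_mono) auto
    also have "\<dots> \<le> degree (?s - p)"
      using card_poly_roots_bound[OF ne] .
    also have "\<dots> \<le> degree p"
      using \<open>degree ?s \<le> degree p\<close> by (intro degree_diff_le) auto
    also have "card (qint q ` {..<Suc (degree p)}) = Suc (degree p)"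
      by (subst card_image) (auto simp: inj_on_def qint_inject)
    finally show False
      by simp
  qed
  then show ?thesis
    unfolding R_minus_q_def using c(1) by (intro CollectI exI[of _ "Suc (degree p)"] exI[of _ c]) auto
qed

section \<open>Counting factorizations\<close>

lemma modtypes_iff:
  assumes "mu \<in> modtypes q" "g \<in> mu"
  shows "g' \<in> mu \<longleftrightarrow> same_modtype q (g :: 'k mat) g'"
proof -
  obtain n g0 where "g0 \<in> unitary_group q n" "mu = {g'. same_modtype q g0 g'}"
    using assms(1) by (auto simp: modtypes_def)
  then show ?thesis
    using assms(2) same_modtype_sym same_modtype_trans by blast
qed

lemma modtypes_unitary:
  assumes "mu \<in> modtypes q" "g \<in> mu" "g \<in> carrier_mat n n"
  shows "(g :: 'k mat) \<in> unitary_group q n"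
proof -
  obtain m where "g \<in> unitary_group q m"
    using assms(1,2) by (auto simp: modtypes_def same_modtype_def)
  then show ?thesis
    using assms(3) by (auto simp: unitary_group_iff)
qed

lemma modtypes_wall:
  assumes mu: "mu \<in> modtypes q" and A: "linj n d A" and A': "linj n' d A'" and gram: "adj A * A = adj A' * A'"
    and S: "S \<in> carrier_mat d d" and mem: "wall A S \<in> mu"
  shows "wall A' S \<in> mu"
proof -
  have "wall A S \<in> unitary_group q n"
    using modtypes_unitary[OF mu mem] wall_carrier[OF linj_carrier[OF A]] .
  then show ?thesis
    using modtypes_iff[OF mu mem] same_modtype_wall[OF A A' gram S] by blast
qed

text \<open>All members of a type, for every \<open>n\<close>, share one invertible \<open>R\<close>
  and one Gram matrix; only the frame \<open>A\<close> varies. This is the finite datum that stands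
  for the type.\<close>

lemma modtypes_rep:
  assumes mu: "mu \<in> modtypes q"
  obtains e m A0 R X where "linj m e (A0 :: 'k mat)" "R \<in> carrier_mat e e" "X \<in> carrier_mat e e" "R * X = 1\<^sub>m e" "wall A0 R \<in> mu"
    "\<And>n g. g \<in> mu \<Longrightarrow> g \<in> unitary_group q n \<Longrightarrow>
      \<exists>A. linj n e A \<and> adj A * A = adj A0 * A0 \<and> g = wall A R"
proof -
  obtain m g0 where g0: "g0 \<in> unitary_group q m" "mu = {g'. same_modtype q g0 g'}"
    using mu by (auto simp: modtypes_def)
  obtain e A0 R X where rep: "linj m e A0" "R \<in> carrier_mat e e" "X \<in> carrier_mat e e" "R * X = 1\<^sub>m e" "g0 = wall A0 R"
    using unitary_wall[OF g0(1)] .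
  have "\<exists>A. linj n e A \<and> adj A * A = adj A0 * A0 \<and> g = wall A R"
    if g: "g \<in> mu" "g \<in> unitary_group q n" for n g
  proof -
    have "same_modtype q (wall A0 R) g"
      using g(1) g0(2) rep(5) by simp
    then obtain A where "linj n e A" "adj A * A = adj A0 * A0" "g = wall A R"
      using same_modtype_wallE[OF _ rep(1-4) g(2)] by blast
    then show ?thesis
      by blast
  qed
  moreover have "wall A0 R \<in> mu"
    using g0 rep(5) same_modtype_refl by simp
  ultimately show ?thesis
    using that[OF rep(1-4)] by blast
qed

definition pairs :: "'k mat set \<Rightarrow> 'k mat set \<Rightarrow> nat \<Rightarrow> 'k mat \<Rightarrow> ('k mat \<times> 'k mat) set" where
  "pairs mu nu n g = {(x, y). x \<in> mu \<and> y \<in> nu \<and> x \<in> unitary_group q n \<and> y \<in> unitary_group q n \<and> x * y = g}"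

text \<open>All presentations of one pair by a frame of size \<open>d\<close>;
  \<open>triples\<close> collects them over all pairs with product \<open>g\<close>. Frames are
  easier to count than pairs, at the price of an overcount by the order of a general linear
  group.\<close>

definition wall_pairs :: "nat \<Rightarrow> nat \<Rightarrow> 'k mat \<times> 'k mat \<Rightarrow> ('k mat \<times> 'k mat \<times> 'k mat) set" where
  "wall_pairs n d p = {(A, S, T). linj n d A \<and> good_pair d S T \<and> p = (wall A S, wall A T)}"

definition triples :: "'k mat set \<Rightarrow> 'k mat set \<Rightarrow> nat \<Rightarrow> nat \<Rightarrow> 'k mat \<Rightarrow> ('k mat \<times> 'k mat \<times> 'k mat) set" where
  "triples mu nu n d g = {(A, S, T). linj n d A \<and> good_pair d S T \<and> (wall A S, wall A T) \<in> pairs mu nu n g}"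

lemma finite_unitary_group [simp]: "finite (unitary_group q n :: 'k mat set)"
  by (rule finite_subset[OF _ finite_carrier_mat[of n n]]) (auto simp: unitary_group_iff)

lemma finite_pairs [simp]: "finite (pairs mu nu n g)"
  by (rule finite_subset[of _ "unitary_group q n \<times> unitary_group q n"]) (auto simp: pairs_def)

lemma finite_triples [simp]: "finite (triples mu nu n d g)"
  by (rule finite_subset[of _ "carrier_mat n d \<times> carrier_mat d d \<times> carrier_mat d d"])
    (auto simp: triples_def good_pair_def linj_carrier)

lemma finite_wall_pairs [simp]: "finite (wall_pairs n d p)"
  by (rule finite_subset[of _ "carrier_mat n d \<times> carrier_mat d d \<times> carrier_mat d d"])
    (auto simp: wall_pairs_def good_pair_def linj_carrier)

text \<open>Two frames of the same pair factor through each other by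
  \<open>good_pair_factor\<close>, so they have equal size and differ by an invertible
  \<open>Q\<close>; the frame determines the coefficient matrices. The presentations thus form a
  single free orbit of the general linear group.\<close>

lemma card_wall_pairs:
  assumes A: "linj n r A" and good: "good_pair r S T" and p: "p = (wall A S, wall A T)"
  shows "card (wall_pairs n d p) = (if d = r then card {Q :: 'k mat. linj r r Q} else 0)"
proof -
  note Ac = linj_carrier[OF A]
  have ST: "S \<in> carrier_mat r r" "T \<in> carrier_mat r r"
    using good by (auto simp: good_pair_def)
  have factor: "\<exists>Q. Q \<in> carrier_mat r d \<and> B = A * Q" and dim: "d = r"
    if B: "linj n d B" "good_pair d S' T'" "p = (wall B S', wall B T')" for d B S' T'
  proof -
    note Bc = linj_carrier[OF B(1)]
    have ST': "S' \<in> carrier_mat d d" "T' \<in> carrier_mat d d"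
      using B(2) by (auto simp: good_pair_def)
    have eq: "wall A S = wall B S'" "wall A T = wall B T'"
      using p B(3) by simp_all
    obtain Q where Q: "Q \<in> carrier_mat r d" "B = A * Q"
      using good_pair_factor[OF B(1,2) Ac ST eq[symmetric]] .
    obtain P where P: "P \<in> carrier_mat d r" "A = B * P"
      using good_pair_factor[OF A good Bc ST' eq] .
    have "linj r d Q"
      by (rule linj_right_factor[of n d A Q r]) (use B(1) Q Ac in auto)
    moreover have "linj d r P"
      by (rule linj_right_factor[of n r B P d]) (use A P Bc in auto)
    ultimately show "d = r"
      using linj_dim_le by (metis le_antisym)
    show "\<exists>Q. Q \<in> carrier_mat r d \<and> B = A * Q"
      using Q by blast
  qed
  show ?thesis
  proof (cases "d = r")
    case True
    have image: "fst ` wall_pairs n r p = (\<lambda>Q. A * Q) ` {Q. linj r r Q}"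
    proof (intro equalityI subsetI)
      fix B assume "B \<in> fst ` wall_pairs n r p"
      then obtain S' T' where B: "linj n r B" "good_pair r S' T'" "p = (wall B S', wall B T')"
        by (auto simp: wall_pairs_def)
      then obtain Q where Q: "Q \<in> carrier_mat r r" "B = A * Q"
        using factor by blast
      have "linj r r Q"
        by (rule linj_right_factor[of n r A Q r]) (use B(1) Q Ac in auto)
      then show "B \<in> (\<lambda>Q. A * Q) ` {Q. linj r r Q}"
        using Q by blast
    next
      fix B assume "B \<in> (\<lambda>Q. A * Q) ` {Q. linj r r Q}"
      then obtain Q where Q: "linj r r Q" "B = A * Q"
        by blast
      note Qc = linj_carrier[OF Q(1)]
      obtain L where L: "L \<in> carrier_mat r r" "L * Q = 1\<^sub>m r" "Q * L = 1\<^sub>m r"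
        using linj_square[OF Q(1)] .
      have adjLQ: "adj L * adj Q = 1\<^sub>m r"
        using arg_cong[OF L(3), of adj] Qc L(1) by (simp add: adj_mult)
      \<comment> \<open>Under the change of frame \<open>B = A * Q\<close> coefficient matrices
        transform by congruence with the inverse \<open>L\<close> of \<open>Q\<close>.\<close>
      have walls: "wall B (L * U * adj L) = wall A U" if U: "U \<in> carrier_mat r r" for U
      proof -
        have "Q * (L * U * adj L) * adj Q = Q * (L * (U * (adj L * adj Q)))"
          using Qc L(1) U by (simp add: mat_mult_assoc)
        also have "\<dots> = U"
          using Qc L U adjLQ by (simp add: mat_left_cancel)
        finally show ?thesis
          using wall_mult_right[OF Ac Qc, of "L * U * adj L"] L(1) U Q(2) by simp
      qed
      obtain X Y where XY: "X \<in> carrier_mat r r" "Y \<in> carrier_mat r r" "S * X + T * Y = 1\<^sub>m r"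
        using good by (auto simp: good_pair_def)
      have adjLQ': "adj L * (adj Q * M) = M" if "M \<in> carrier_mat r r" for M
        using mat_left_cancel[OF adjLQ, of M] that L(1) Qc by simp
      have "(L * S * adj L) * (adj Q * X * Q) + (L * T * adj L) * (adj Q * Y * Q) = L * ((S * X + T * Y) * Q)"
        using L(1) Qc ST XY(1,2) by (simp add: mat_mult_assoc mat_mult_add mat_add_mult adjLQ')
      also have "\<dots> = 1\<^sub>m r"
        using XY(3) L Qc by simp
      finally have "good_pair r (L * S * adj L) (L * T * adj L)"
        unfolding good_pair_def using L(1) Qc ST XY(1,2)
        by (intro conjI bexI[of _ "adj Q * X * Q"] bexI[of _ "adj Q * Y * Q"]) auto
      then have "(B, L * S * adj L, L * T * adj L) \<in> wall_pairs n r p"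
        using walls ST p linj_mult[OF A Q(1)] Q(2) by (simp add: wall_pairs_def)
      then show "B \<in> fst ` wall_pairs n r p"
        by force
    qed
    have "inj_on fst (wall_pairs n r p)"
      by (auto simp: inj_on_def wall_pairs_def good_pair_def intro: wall_inject)
    then have "card (wall_pairs n r p) = card (fst ` wall_pairs n r p)"
      by (simp add: card_image)
    also have "\<dots> = card {Q :: 'k mat. linj r r Q}"
      unfolding image using linj_cancel[OF A] linj_carrier by (intro card_image inj_onI) blast
    finally show ?thesis
      using True by simp
  next
    case False
    then have "wall_pairs n d p = {}"
      using dim by (auto simp: wall_pairs_def)
    then show ?thesis
      using False by simp
  qed
qed

lemma card_invertible_pos: "card {Q :: 'k mat. linj r r Q} > 0"
proof -
  have "linj r r (1\<^sub>m r :: 'k mat)"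
    by (auto simp: linj_def intro!: bexI[of _ "1\<^sub>m r"])
  then show ?thesis
    by (auto simp: card_gt_0_iff)
qed

text \<open>For each pair exactly one size \<open>d\<close> contributes, and the number of its
  presentations cancels against the denominator. The bound \<open>D\<close> ensures that this size
  is among the summands.\<close>

lemma card_pairs_eq_triples:
  assumes D: "\<And>d A S T. linj n d A \<Longrightarrow> good_pair d S T \<Longrightarrow> (wall A S, wall A T) \<in> pairs mu nu n g \<Longrightarrow> d \<le> D"
  shows "rat_of_nat (card (pairs mu nu n g)) =
    (\<Sum>d\<le>D. rat_of_nat (card (triples mu nu n d g)) / of_nat (card {Q :: 'k mat. linj d d Q}))"
proof -
  let ?GL = "\<lambda>d. rat_of_nat (card {Q :: 'k mat. linj d d Q})"
  have fibres: "card (triples mu nu n d g) = (\<Sum>p\<in>pairs mu nu n g. card (wall_pairs n d p))" for d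
  proof -
    let ?f = "\<lambda>(A, S, T). (wall A S, wall A T)"
    have "(\<Sum>p\<in>pairs mu nu n g. \<Sum>t\<in>{t \<in> triples mu nu n d g. ?f t = p}. 1) = (\<Sum>t\<in>triples mu nu n d g. 1 :: nat)"
      by (rule sum.group) (simp, simp, auto simp: triples_def)
    moreover have "{t \<in> triples mu nu n d g. ?f t = p} = wall_pairs n d p" if "p \<in> pairs mu nu n g" for p
      using that by (auto simp: triples_def wall_pairs_def)
    ultimately show ?thesis
      by simp
  qed
  have one: "(\<Sum>d\<le>D. rat_of_nat (card (wall_pairs n d p)) / ?GL d) = 1" if p: "p \<in> pairs mu nu n g" for p
  proof -
    obtain x y where xy: "p = (x, y)" "x \<in> unitary_group q n" "y \<in> unitary_group q n"
      using p by (auto simp: pairs_def)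
    obtain r A S T where A: "linj n r A" "good_pair r S T" "x = wall A S" "y = wall A T"
      using unitary_pair_wall[OF xy(2,3)] .
    have "r \<le> D"
      using D[OF A(1,2)] p xy(1) A(3,4) by simp
    have GL: "?GL d \<noteq> 0" for d
      by (metis card_invertible_pos less_numeral_extra(3) of_nat_eq_0_iff)
    have "p = (wall A S, wall A T)"
      using xy(1) A(3,4) by simp
    note card = card_wall_pairs[OF A(1,2) this]
    have "rat_of_nat (card (wall_pairs n d p)) / ?GL d = (if d = r then 1 else 0)" for d
      by (cases "d = r") (simp_all only: card GL if_True if_False of_nat_0 div_0 divide_self refl not_False_eq_True)
    then have "(\<Sum>d\<le>D. rat_of_nat (card (wall_pairs n d p)) / ?GL d) = (\<Sum>d\<le>D. if d = r then 1 else 0)"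
      by simp
    then show ?thesis
      using \<open>r \<le> D\<close> by simp
  qed
  have "(\<Sum>d\<le>D. rat_of_nat (card (triples mu nu n d g)) / ?GL d) =
      (\<Sum>d\<le>D. \<Sum>p\<in>pairs mu nu n g. rat_of_nat (card (wall_pairs n d p)) / ?GL d)"
    by (simp add: fibres sum_divide_distrib)
  also have "\<dots> = (\<Sum>p\<in>pairs mu nu n g. \<Sum>d\<le>D. rat_of_nat (card (wall_pairs n d p)) / ?GL d)"
    by (rule sum.swap)
  also have "\<dots> = rat_of_nat (card (pairs mu nu n g))"
    by (simp add: one)
  finally show ?thesis
    by simp
qed

text \<open>Quantifying over all \<open>n\<close> and \<open>A\<close> makes this a property of the
  Gram matrix and \<open>S\<close> alone; by \<open>local_type_wall\<close> any single realization
  decides it.\<close>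

definition local_type :: "'k mat set \<Rightarrow> nat \<Rightarrow> 'k mat \<Rightarrow> 'k mat \<Rightarrow> bool" where
  "local_type mu d H S \<longleftrightarrow> (\<exists>n A. linj n d A \<and> adj A * A = H \<and> wall A S \<in> mu)"

text \<open>
  For \<open>g = wall A0 R\<close> with Gram matrix \<open>H0\<close> of \<open>A0\<close>, the matrix \<open>P\<close> expresses \<open>A0\<close> in the basis
  \<open>A\<close>, and \<open>S + T + S * H * T\<close> is the matrix of \<open>wall A S * wall A T\<close>.
\<close>

definition local_data :: "'k mat set \<Rightarrow> 'k mat set \<Rightarrow> nat \<Rightarrow> nat \<Rightarrow> 'k mat \<Rightarrow> 'k mat \<Rightarrow>
    ('k mat \<times> 'k mat \<times> 'k mat \<times> 'k mat) set" where
  "local_data mu nu d e H0 R = {(H, S, T, P). H \<in> carrier_mat d d \<and> good_pair d S T \<and>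
     local_type mu d H S \<and> local_type nu d H T \<and> linj d e P \<and>
     P * R * adj P = S + T + S * H * T \<and> adj P * H * P = H0}"

lemma finite_local_data [simp]: "finite (local_data mu nu d e H0 R)"
  by (rule finite_subset[of _ "carrier_mat d d \<times> carrier_mat d d \<times> carrier_mat d d \<times> carrier_mat d e"])
    (auto simp: local_data_def good_pair_def linj_carrier)

lemma local_type_wall:
  assumes "mu \<in> modtypes q" "linj n d A" "S \<in> carrier_mat d d"
  shows "local_type mu d (adj A * A) S \<longleftrightarrow> wall A S \<in> mu \<and> wall A S \<in> unitary_group q n"
  using assms modtypes_wall modtypes_unitary[of mu "wall A S" n] wall_carrier[OF linj_carrier[OF assms(2)]]
  unfolding local_type_def by (metis (no_types))

text \<open>A triple determines its local data: \<open>H\<close> is the Gram matrix of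
  \<open>A\<close>, and \<open>P\<close> is unique since \<open>A\<close> is injective. Once the
  data are fixed, the conditions on \<open>S\<close> and \<open>T\<close> no longer involve
  \<open>A\<close>, and only the extensions remain to be counted.\<close>

lemma card_triples:
  assumes mu: "mu \<in> modtypes q" and nu: "nu \<in> modtypes q"
    and A0: "linj n e A0" and R: "R \<in> carrier_mat e e" "X \<in> carrier_mat e e" "R * X = 1\<^sub>m e"
  shows "card (triples mu nu n d (wall A0 R)) =
    (\<Sum>(H, S, T, P)\<in>local_data mu nu d e (adj A0 * A0) R. card (extensions n d H P A0))"
proof -
  note A0c = linj_carrier[OF A0]
  let ?I = "local_data mu nu d e (adj A0 * A0) R"
  let ?Sigma = "SIGMA i:?I. case i of (H, S, T, P) \<Rightarrow> extensions n d H P A0"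
  let ?f = "\<lambda>((H, S, T, P), A). (A, S, T)"
  have inj: "inj_on ?f ?Sigma"
  proof (rule inj_onI, clarsimp, intro conjI)
    fix H S T P A H' P'
    assume "(H, S, T, P) \<in> ?I" "A \<in> extensions n d H P A0" "(H', S, T, P') \<in> ?I" "A \<in> extensions n d H' P' A0"
    then have "linj n d A" "P \<in> carrier_mat d e" "P' \<in> carrier_mat d e" "A * P = A * P'" "adj A * A = H" "adj A * A = H'"
      by (auto simp: extensions_def local_data_def dest: linj_carrier)
    then show "H = H'" "P = P'"
      using linj_cancel by blast+
  qed
  have image: "?f ` ?Sigma = triples mu nu n d (wall A0 R)"
  proof (intro equalityI subsetI)
    fix t assume "t \<in> ?f ` ?Sigma"
    then obtain H S T P A where t: "t = (A, S, T)" and i: "(H, S, T, P) \<in> ?I" and ext: "A \<in> extensions n d H P A0"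
      by auto
    have A: "linj n d A" "adj A * A = H" "A * P = A0"
      using ext by (auto simp: extensions_def)
    note Ac = linj_carrier[OF A(1)]
    have d: "good_pair d S T" "local_type mu d H S" "local_type nu d H T" "linj d e P"
      "P * R * adj P = S + T + S * H * T"
      using i by (auto simp: local_data_def)
    have ST: "S \<in> carrier_mat d d" "T \<in> carrier_mat d d"
      using d(1) by (auto simp: good_pair_def)
    have "wall A S * wall A T = wall A0 R"
      using wall_mult[OF Ac ST] wall_mult_right[OF Ac linj_carrier[OF d(4)] R(1)] d(5) A(2,3) by simp
    then show "t \<in> triples mu nu n d (wall A0 R)"
      using t A(1) d(1-3) local_type_wall[OF mu A(1) ST(1)] local_type_wall[OF nu A(1) ST(2)]
      by (simp add: triples_def pairs_def A(2))
  next
    fix t assume "t \<in> triples mu nu n d (wall A0 R)"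
    then obtain A S T where t: "t = (A, S, T)" and A: "linj n d A" and good: "good_pair d S T"
      and mem: "wall A S \<in> mu" "wall A S \<in> unitary_group q n" "wall A T \<in> nu" "wall A T \<in> unitary_group q n"
      and prod: "wall A S * wall A T = wall A0 R"
      by (auto simp: triples_def pairs_def)
    note Ac = linj_carrier[OF A]
    let ?H = "adj A * A"
    let ?U = "S + T + S * ?H * T"
    have ST: "S \<in> carrier_mat d d" "T \<in> carrier_mat d d"
      using good by (auto simp: good_pair_def)
    have U: "?U \<in> carrier_mat d d"
      using ST Ac by auto
    have wallU: "wall A ?U = wall A0 R"
      using wall_mult[OF Ac ST] prod by simp
    have "R * X + 0\<^sub>m e e * X = 1\<^sub>m e"
      using R by simp
    then have "good_pair e R (0\<^sub>m e e)"
      unfolding good_pair_def using R(1,2) zero_carrier_mat by blast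
    \<comment> \<open>The pair of \<open>g\<close> and the identity has the minimal frame
      \<open>A0\<close>; since \<open>A\<close> presents it too, with coefficient matrices
      \<open>?U\<close> and 0, \<open>A0\<close> factors through \<open>A\<close>.\<close>
    then obtain P where P: "P \<in> carrier_mat d e" "A0 = A * P"
      using good_pair_factor[OF A0 _ Ac U zero_carrier_mat wallU[symmetric]] wall_zero[OF A0c] wall_zero[OF Ac] by metis
    have linP: "linj d e P"
      by (rule linj_right_factor[of n e A P d]) (use A0 P Ac in auto)
    have "wall A (P * R * adj P) = wall A ?U"
      using wall_mult_right[OF Ac P(1) R(1)] P(2) wallU by simp
    then have "P * R * adj P = ?U"
      by (rule wall_inject[OF A _ U, rotated]) (use P(1) R(1) in auto)
    moreover have "adj P * ?H * P = adj A0 * A0"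
      using P Ac by (simp add: adj_mult mat_mult_assoc)
    ultimately have "(?H, S, T, P) \<in> ?I"
      using mem good linP Ac local_type_wall[OF mu A ST(1)] local_type_wall[OF nu A ST(2)]
      by (simp add: local_data_def)
    moreover have "A \<in> extensions n d ?H P A0"
      using A P(2) by (simp add: extensions_def)
    ultimately show "t \<in> ?f ` ?Sigma"
      unfolding t by (intro image_eqI[of _ _ "((?H, S, T, P), A)"]) auto
  qed
  have "card (triples mu nu n d (wall A0 R)) = card ?Sigma"
    unfolding image[symmetric] by (rule card_image[OF inj])
  also have "\<dots> = (\<Sum>i\<in>?I. card (case i of (H, S, T, P) \<Rightarrow> extensions n d H P A0))"
    by (rule card_SigmaI) auto
  finally show ?thesis
    by (simp add: case_prod_unfold)
qed

lemma pairs_dim_bound: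
  assumes mu: "mu \<in> modtypes q" and nu: "nu \<in> modtypes q"
  obtains D where "\<And>n g d A S T. linj n d A \<Longrightarrow> good_pair d S T \<Longrightarrow>
    (wall A S, wall A T) \<in> pairs mu nu n g \<Longrightarrow> d \<le> D"
proof -
  obtain a m A0 R X where a: "R \<in> carrier_mat a a"
    "\<And>n g. g \<in> mu \<Longrightarrow> g \<in> unitary_group q n \<Longrightarrow> \<exists>A. linj n a A \<and> adj A * A = adj A0 * A0 \<and> g = wall A R"
    using modtypes_rep[OF mu] by metis
  obtain b m' B0 R' X' where b: "R' \<in> carrier_mat b b"
    "\<And>n g. g \<in> nu \<Longrightarrow> g \<in> unitary_group q n \<Longrightarrow> \<exists>A. linj n b A \<and> adj A * A = adj B0 * B0 \<and> g = wall A R'"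
    using modtypes_rep[OF nu] by metis
  have "d \<le> a + b"
    if A: "linj n d A" "good_pair d S T" "(wall A S, wall A T) \<in> pairs mu nu n g" for n g d A S T
  proof -
    obtain B where B: "linj n a B" "wall A S = wall B R"
      using a(2)[of "wall A S" n] A(3) by (auto simp: pairs_def)
    obtain C where C: "linj n b C" "wall A T = wall C R'"
      using b(2)[of "wall A T" n] A(3) by (auto simp: pairs_def)
    show ?thesis
      using good_pair_dim_le[OF A(1,2) linj_carrier[OF B(1)] a(1) linj_carrier[OF C(1)] b(1) B(2) C(2)] .
  qed
  then show ?thesis
    using that by blast
qed

lemma card_pairs_poly:
  assumes mu: "mu \<in> modtypes q" and nu: "nu \<in> modtypes q" and lam: "lam \<in> modtypes q"
  obtains p where "\<And>n g. g \<in> lam \<Longrightarrow> g \<in> unitary_group q n \<Longrightarrow>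
    rat_of_nat (card (pairs mu nu n g)) = poly p (qint q n)"
proof -
  obtain D where D: "\<And>n g d A S T. linj n d A \<Longrightarrow> good_pair d S T \<Longrightarrow>
    (wall A S, wall A T) \<in> pairs mu nu n g \<Longrightarrow> d \<le> D"
    using pairs_dim_bound[OF mu nu] by blast
  obtain e m B R X where B: "linj m e B" "R \<in> carrier_mat e e" "X \<in> carrier_mat e e" "R * X = 1\<^sub>m e"
    "\<And>n g. g \<in> lam \<Longrightarrow> g \<in> unitary_group q n \<Longrightarrow> \<exists>A. linj n e A \<and> adj A * A = adj B * B \<and> g = wall A R"
    using modtypes_rep[OF lam] by metis
  let ?I = "\<lambda>d. local_data mu nu d e (adj B * B) R"
  let ?P = "\<lambda>d H P f. \<forall>n A0. linj n e A0 \<longrightarrow> adj A0 * A0 = adj B * B \<longrightarrow>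
      rat_of_nat (card (extensions n d H P A0)) = poly f (mq ^ n)"
  \<comment> \<open>Chosen before \<open>n\<close> and \<open>A0\<close> are known: one polynomial
    per local datum serves all of them at once.\<close>
  define F where "F d H P = (SOME f. ?P d H P f)" for d H P
  have F: "rat_of_nat (card (extensions n d H P A0)) = poly (F d H P) (mq ^ n)"
    if "(H, S, T, P) \<in> ?I d" "linj n e A0" "adj A0 * A0 = adj B * B" for d H S T P n A0
  proof -
    have "linj d e P" "H \<in> carrier_mat d d" "adj P * H * P = adj B * B"
      using that(1) by (auto simp: local_data_def)
    then have "\<exists>f. ?P d H P f"
      using extension_poly[of d e P H] by metis
    then have "?P d H P (F d H P)"
      unfolding F_def by (rule someI_ex)
    then show ?thesis
      using that(2,3) by blast
  qed
  define f where "f = (\<Sum>d\<le>D. smult (1 / of_nat (card {Q :: 'k mat. linj d d Q})) (\<Sum>(H, S, T, P)\<in>?I d. F d H P))"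
  \<comment> \<open>The substitution \<open>1 + (mq - 1) * x\<close> turns a polynomial in
    \<open>mq ^ n\<close> into one in \<open>qint q n\<close>.\<close>
  have "rat_of_nat (card (pairs mu nu n g)) = poly (pcompose f [:1, mq - 1:]) (qint q n)"
    if g: "g \<in> lam" "g \<in> unitary_group q n" for n g
  proof -
    obtain A0 where A0: "linj n e A0" "adj A0 * A0 = adj B * B" "g = wall A0 R"
      using B(5)[OF g] by blast
    have triples: "rat_of_nat (card (triples mu nu n d g)) = poly (\<Sum>(H, S, T, P)\<in>?I d. F d H P) (mq ^ n)" for d
    proof -
      have "rat_of_nat (card (triples mu nu n d g)) = (\<Sum>(H, S, T, P)\<in>?I d. rat_of_nat (card (extensions n d H P A0)))"
        unfolding A0(3) card_triples[OF mu nu A0(1) B(2-4)] A0(2) by (simp add: case_prod_unfold)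
      also have "\<dots> = (\<Sum>(H, S, T, P)\<in>?I d. poly (F d H P) (mq ^ n))"
        by (rule sum.cong[OF refl]) (use F A0 in auto)
      finally show ?thesis
        by (simp add: poly_sum case_prod_unfold)
    qed
    have "rat_of_nat (card (pairs mu nu n g)) =
        (\<Sum>d\<le>D. rat_of_nat (card (triples mu nu n d g)) / of_nat (card {Q :: 'k mat. linj d d Q}))"
      by (rule card_pairs_eq_triples) (rule D)
    also have "\<dots> = poly f (mq ^ n)"
      unfolding f_def triples poly_sum poly_smult by simp
    finally show ?thesis
      by (simp add: poly_pcompose mq_power_eq[of n] mult.commute)
  qed
  then show ?thesis
    using that by blast
qed

text \<open>Padding by zero rows keeps a type alive in every larger group. Hence for all large
  \<open>n\<close> the structure polynomial takes values that are actual cardinalities, the input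
  for integrality.\<close>

lemma modtype_in_larger_group:
  assumes lam: "lam \<in> modtypes q"
  obtains n0 where "\<And>n. n \<ge> n0 \<Longrightarrow> \<exists>g :: 'k mat. g \<in> lam \<and> g \<in> unitary_group q n"
proof -
  obtain e m B R X where B: "linj m e B" "R \<in> carrier_mat e e" "wall B R \<in> lam"
    using modtypes_rep[OF lam] by metis
  note Bc = linj_carrier[OF B(1)]
  have "\<exists>g. g \<in> lam \<and> g \<in> unitary_group q n" if "n \<ge> m" for n
  proof -
    define k where "k = n - m"
    have n: "n = m + k"
      using that by (simp add: k_def)
    have V: "linj n e (vcat B (0\<^sub>m k e))"
      using vcat_linj[OF Bc] B(1) by (simp add: n)
    have "wall (vcat B (0\<^sub>m k e)) R \<in> lam"
      using modtypes_wall[OF lam B(1) V _ B(2,3)] gram_vcat_zero[OF Bc] by simp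
    then show ?thesis
      using modtypes_unitary[OF lam] wall_carrier[OF linj_carrier[OF V]] by blast
  qed
  then show ?thesis
    using that by blast
qed

text \<open>The type of a product is fixed by the size, the Gram matrix and the two coefficient
  matrices; with sizes bounded by \<open>D\<close>, a finite field allows only finitely many such
  data.\<close>

lemma finite_product_types:
  assumes mu: "mu \<in> modtypes q" and nu: "nu \<in> modtypes q"
  shows "finite {lam \<in> modtypes q. \<exists>n. \<exists>g\<in>lam. g \<in> unitary_group q n \<and> pairs mu nu n g \<noteq> {}}"
proof -
  obtain D where D: "\<And>n g d A S T. linj n d A \<Longrightarrow> good_pair d S T \<Longrightarrow>
    (wall A S, wall A T) \<in> pairs mu nu n g \<Longrightarrow> d \<le> D"
    using pairs_dim_bound[OF mu nu] by blast
  define types where "types d H S T = {lam \<in> modtypes q. \<exists>n A. linj n d A \<and> adj A * A = H \<and>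
    S \<in> carrier_mat d d \<and> T \<in> carrier_mat d d \<and> wall A S * wall A T \<in> lam}" for d H S T
  have unique: "lam = lam'" if t: "lam \<in> types d H S T" "lam' \<in> types d H S T" for d H S T lam lam'
  proof -
    obtain n A where A: "linj n d A" "adj A * A = H" "wall A S * wall A T \<in> lam"
      using t(1) unfolding types_def by blast
    obtain n' A' where A': "linj n' d A'" "adj A' * A' = H" "wall A' S * wall A' T \<in> lam'"
      using t(2) unfolding types_def by blast
    have ST: "S \<in> carrier_mat d d" "T \<in> carrier_mat d d" and lam: "lam \<in> modtypes q" "lam' \<in> modtypes q"
      using t unfolding types_def by blast+
    let ?U = "S + T + S * H * T"
    have H: "H \<in> carrier_mat d d"
      using A(2) linj_carrier[OF A(1)] by auto
    have U: "?U \<in> carrier_mat d d"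
      using ST H by auto
    have "wall A ?U \<in> lam" and mem': "wall A' ?U \<in> lam'"
      using A A' wall_mult[OF linj_carrier[OF A(1)] ST] wall_mult[OF linj_carrier[OF A'(1)] ST] by simp_all
    then have "wall A' ?U \<in> lam"
      using modtypes_wall[OF lam(1) A(1) A'(1) _ U] A(2) A'(2) by simp
    then show ?thesis
      using modtypes_iff[OF lam(1), of "wall A' ?U"] modtypes_iff[OF lam(2) mem'] by blast
  qed
  have "finite (types d H S T)" for d H S T
  proof (cases "types d H S T = {}")
    case False
    then obtain lam where "lam \<in> types d H S T"
      by blast
    then have "types d H S T \<subseteq> {lam}"
      using unique by blast
    then show ?thesis
      by (rule finite_subset) simp
  qed simp
  then have "finite (\<Union>d\<in>{..D}. \<Union>H\<in>carrier_mat d d. \<Union>S\<in>carrier_mat d d. \<Union>T\<in>carrier_mat d d. types d H S T)"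
    by (intro finite_UN_I) auto
  moreover have "{lam \<in> modtypes q. \<exists>n. \<exists>g\<in>lam. g \<in> unitary_group q n \<and> pairs mu nu n g \<noteq> {}} \<subseteq>
      (\<Union>d\<in>{..D}. \<Union>H\<in>carrier_mat d d. \<Union>S\<in>carrier_mat d d. \<Union>T\<in>carrier_mat d d. types d H S T)"
  proof
    fix lam assume "lam \<in> {lam \<in> modtypes q. \<exists>n. \<exists>g\<in>lam. g \<in> unitary_group q n \<and> pairs mu nu n g \<noteq> {}}"
    then obtain n g x y where lam: "lam \<in> modtypes q" "g \<in> lam" and p: "(x, y) \<in> pairs mu nu n g"
      by auto
    have xy: "x \<in> unitary_group q n" "y \<in> unitary_group q n" "x * y = g"
      using p by (auto simp: pairs_def)
    obtain d A S T where A: "linj n d A" "good_pair d S T" "x = wall A S" "y = wall A T"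
      using unitary_pair_wall[OF xy(1,2)] .
    have "d \<le> D"
      using D[OF A(1,2)] p A(3,4) by simp
    moreover have ST: "S \<in> carrier_mat d d" "T \<in> carrier_mat d d"
      using A(2) by (auto simp: good_pair_def)
    moreover have "adj A * A \<in> carrier_mat d d"
      using linj_carrier[OF A(1)] by simp
    moreover have "lam \<in> types d (adj A * A) S T"
      using lam xy(3) A ST by (auto simp: types_def)
    ultimately show "lam \<in> (\<Union>d\<in>{..D}. \<Union>H\<in>carrier_mat d d. \<Union>S\<in>carrier_mat d d. \<Union>T\<in>carrier_mat d d. types d H S T)"
      by blast
  qed
  ultimately show ?thesis
    by (rule rev_finite_subset)
qed

lemma galg_mult_class_sum:
  "galg_mult q n (class_sum q mu n) (class_sum q nu n) g = rat_of_nat (card (pairs mu nu n (g :: 'k mat)))"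
proof -
  let ?U = "unitary_group q n :: 'k mat set"
  let ?all = "{(x, y). x \<in> ?U \<and> y \<in> ?U \<and> x * y = g}"
  have "galg_mult q n (class_sum q mu n) (class_sum q nu n) g =
      (\<Sum>p\<in>?all. if p \<in> pairs mu nu n g then 1 else 0)"
    unfolding galg_mult_def by (rule sum.cong) (auto simp: class_sum_def pairs_def split: if_splits)
  also have "\<dots> = rat_of_nat (card (?all \<inter> {p. p \<in> pairs mu nu n g}))"
    by (subst sum.If_cases) (auto intro: finite_subset[of _ "?U \<times> ?U"])
  also have "?all \<inter> {p. p \<in> pairs mu nu n g} = pairs mu nu n g"
    by (auto simp: pairs_def)
  finally show ?thesis .
qed

lemma structure_polynomials:
  assumes mu: "mu \<in> modtypes q" and nu: "nu \<in> modtypes q"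
  shows "\<exists>r :: 'k mat set \<Rightarrow> rat poly.
    (\<forall>lam \<in> modtypes q. r lam \<in> R_minus_q q) \<and>
    finite {lam \<in> modtypes q. r lam \<noteq> 0} \<and>
    (\<forall>n. galg_mult q n (class_sum q mu n) (class_sum q nu n) =
      (\<lambda>g. \<Sum>lam \<in> {lam \<in> modtypes q. r lam \<noteq> 0}. poly (r lam) (qint q n) * class_sum q lam n g))"
proof -
  define occurs where "occurs lam \<longleftrightarrow> (\<exists>n. \<exists>g\<in>lam. g \<in> unitary_group q n \<and> pairs mu nu n g \<noteq> {})" for lam
  have "\<exists>p. \<forall>n g. g \<in> lam \<longrightarrow> g \<in> unitary_group q n \<longrightarrow>
      rat_of_nat (card (pairs mu nu n g)) = poly p (qint q n)" if "lam \<in> modtypes q" for lam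
    using card_pairs_poly[OF mu nu that] by metis
  then obtain p where p: "\<And>lam n g. lam \<in> modtypes q \<Longrightarrow> g \<in> lam \<Longrightarrow> g \<in> unitary_group q n \<Longrightarrow>
      rat_of_nat (card (pairs mu nu n g)) = poly (p lam) (qint q n)"
    by metis
  \<comment> \<open>For a type that never arises in a product the polynomial is set to zero
    outright: all counts there are zero, and finiteness of the support becomes
    \<open>finite_product_types\<close>.\<close>
  define r where "r lam = (if occurs lam then p lam else 0)" for lam
  have r: "rat_of_nat (card (pairs mu nu n g)) = poly (r lam) (qint q n)"
    if "lam \<in> modtypes q" "g \<in> lam" "g \<in> unitary_group q n" for lam n g
    using p[OF that] that by (auto simp: r_def occurs_def)
  have "r lam \<in> R_minus_q q" if lam: "lam \<in> modtypes q" for lam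
  proof -
    obtain n0 where n0: "\<And>n. n \<ge> n0 \<Longrightarrow> \<exists>g. g \<in> lam \<and> g \<in> unitary_group q n"
      using modtype_in_larger_group[OF lam] by blast
    have "laurent_int q (poly (r lam) (qint q n))" if "n \<ge> n0" for n
      using n0[OF that] r[OF lam] laurent_of_nat by metis
    then show ?thesis
      by (rule R_minus_qI)
  qed
  moreover have fin: "finite {lam \<in> modtypes q. r lam \<noteq> 0}"
    by (rule finite_subset[OF _ finite_product_types[OF mu nu]]) (auto simp: r_def occurs_def)
  moreover have "galg_mult q n (class_sum q mu n) (class_sum q nu n) g =
      (\<Sum>lam \<in> {lam \<in> modtypes q. r lam \<noteq> 0}. poly (r lam) (qint q n) * class_sum q lam n g)" for n g
  proof (cases "g \<in> unitary_group q n")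
    case False
    \<comment> \<open>Both sides are functions on all matrices, so arguments outside the group have
      to be settled as well: products of unitary matrices are unitary.\<close>
    have "pairs mu nu n g = {}"
    proof (rule ccontr)
      assume "pairs mu nu n g \<noteq> {}"
      then obtain x y where xy: "x \<in> unitary_group q n" "y \<in> unitary_group q n" "x * y = g"
        by (auto simp: pairs_def)
      then have c: "x \<in> carrier_mat n n" "y \<in> carrier_mat n n" "adj x * x = 1\<^sub>m n" "adj y * y = 1\<^sub>m n"
        by (auto simp: unitary_group_iff)
      have "adj (x * y) * (x * y) = adj y * (adj x * (x * y))"
        using c(1,2) by (simp add: adj_mult mat_mult_assoc)
      also have "adj x * (x * y) = y"
        using c by (intro mat_left_cancel) auto
      finally have "g \<in> unitary_group q n"
        using xy(3) c by (auto simp: unitary_group_iff)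
      with False show False ..
    qed
    moreover have "class_sum q lam n g = 0" for lam
      using False by (simp add: class_sum_def)
    ultimately show ?thesis
      by (simp add: galg_mult_class_sum)
  next
    case True
    define lam0 where "lam0 = {g'. same_modtype q g g'}"
    have lam0: "lam0 \<in> modtypes q" "g \<in> lam0"
      using True same_modtype_refl by (auto simp: lam0_def modtypes_def)
    \<comment> \<open>Types are equivalence classes, so at most one summand is nonzero at
      \<open>g\<close>.\<close>
    have mem_iff: "g \<in> lam \<longleftrightarrow> lam = lam0" if "lam \<in> modtypes q" for lam
      using modtypes_iff[OF that, of g] lam0(2) by (auto simp: lam0_def)
    have "(\<Sum>lam \<in> {lam \<in> modtypes q. r lam \<noteq> 0}. poly (r lam) (qint q n) * class_sum q lam n g) =
        (\<Sum>lam \<in> {lam \<in> modtypes q. r lam \<noteq> 0}. if lam = lam0 then poly (r lam0) (qint q n) else 0)"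
      by (rule sum.cong) (auto simp: class_sum_def True mem_iff)
    also have "\<dots> = poly (r lam0) (qint q n)"
      using fin lam0(1) by simp
    finally show ?thesis
      using r[OF lam0 True] by (simp add: galg_mult_class_sum)
  qed
  ultimately show ?thesis
    by (intro exI[of _ r]) auto
qed

end

theorem theorem8p2:
  fixes q :: nat
  assumes "\<exists>p k. prime p \<and> k \<ge> 1 \<and> q = p ^ k"
      and "card (UNIV :: ('k::{finite,field}) set) = q ^ 2"
  shows "\<forall>mu \<in> (modtypes q :: 'k mat set set). \<forall>nu \<in> modtypes q.
           \<exists>r :: 'k mat set \<Rightarrow> rat poly.
             (\<forall>lam \<in> modtypes q. r lam \<in> R_minus_q q) \<and>
             finite {lam \<in> modtypes q. r lam \<noteq> 0} \<and>
             (\<forall>n. galg_mult q n (class_sum q mu n) (class_sum q nu n) =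
                  (\<lambda>g. \<Sum>lam \<in> {lam \<in> modtypes q. r lam \<noteq> 0}.
                          poly (r lam) (qint q n) * class_sum q lam n g))"
proof -
  interpret hermitian_field q "TYPE('k)"
    using assms by unfold_locales
  show ?thesis
    using structure_polynomials by blast
qed

end
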